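(* Let $p\ge1$, $s\ge0$, $\ell\ge2$ be integers, let $\omega_1,\ldots,\omega_p>0$ be linearly independent over the rationals, and let $(d,\kappa)=(p,2p)$ or $(d,\kappa)=(p+1,2p+1)$. For $\tau\in\mathbb{R}^d$ let $\mathcal{E}^\ell_\tau$, $A$ and $\Pi$ be the linear maps defined in the context. Then there is an open and dense set $\mathcal{U}\subset\mathbb{R}^d$ such that for all $\tau\in\mathcal{U}$ the linear mapping $$\Pi\circ A\circ\mathcal{E}^\ell_\tau:H^{d+s}_\ell(\mathbb{R})\to H^{d+s}_\ell(\mathbb{R}^d,\mathbb{Z}_{2,p})$$ is surjective.
   Context: Complex coordinates. $\mathbb{R}^\kappa$ is identified with $\{x=(x_1,\overline{x_1},\ldots,x_p,\overline{x_p}):x_j\in\mathbb{C}\}$ if $\kappa=2p$, and with $\{x=(x_0,x_1,\overline{x_1},\ldots,x_p,\overline{x_p}):x_0\in\mathbb{R},x_j\in\mathbb{C}\}$ if $\kappa=2p+1$. $\Gamma_0\cong\mathbb{T}^p$ is the group of matrices $\mathrm{diag}(e^{i\theta_1},e^{-i\theta_1},\ldots,e^{i\theta_p},e^{-i\theta_p})$, resp. $\mathrm{diag}(1,e^{i\theta_1},e^{-i\theta_1},\ldots,e^{i\theta_p},e^{-i\theta_p})$. Spaces. $\mu=(\mu_1,\ldots,\mu_s)$. $H^{\kappa+s}_\ell(\mathbb{R}^\kappa)$: homogeneous polynomial maps of degree $\ell$ in $(x,\mu)\in\mathbb{R}^\kappa\times\mathbb{R}^s$ with values in $\mathbb{R}^\kappa$.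 $H^{\kappa+s}_\ell(\mathbb{R}^\kappa,\mathbb{T}^p)$: those $f$ with $f(\gamma x,\mu)=\gamma f(x,\mu)$ for all $\gamma\in\Gamma_0$; the general such $f$ has components $a_j(x_1\overline{x_1},\ldots,x_p\overline{x_p},\mu)x_j$ and their conjugates, $j=1,\ldots,p$ (if $\kappa=2p$), or a real first component $a_0(x_0,x_1\overline{x_1},\ldots,x_p\overline{x_p},\mu)$ followed by $a_j(x_0,x_1\overline{x_1},\ldots,x_p\overline{x_p},\mu)x_j$ and conjugates (if $\kappa=2p+1$). $H^{d+s}_\ell(\mathbb{R})$: real homogeneous polynomials of degree $\ell$ in $d+s$ variables $(v,\mu)$. $\mathbb{Z}_{2,p}$ acts on $\mathbb{R}^d\ni\rho$, $\rho=(\rho_1,\ldots,\rho_p)$ if $d=p$ and $\rho=(\rho_0,\ldots,\rho_p)$ if $d=p+1$, by $\rho_j\mapsto\lambda_j\rho_j$, $\lambda_j\in\{1,-1\}$, $j=1,\ldots,p$ (fixing $\rho_0$). $H^{d+s}_\ell(\mathbb{R}^d,\mathbb{Z}_{2,p})$: homogeneous polynomial maps of degree $\ell$ in $(\rho,\mu)$ with values in $\mathbb{R}^d$ that are $\mathbb{Z}_{2,p}$-equivariant. Maps. $A:H^{\kappa+s}_\ell(\mathbb{R}^\kappa)\to H^{\kappa+s}_\ell(\mathbb{R}^\kappa,\mathbb{T}^p)$, $(Af)(x,\mu)=\int_{\Gamma_0}\gamma f(\gamma^{-1}x,\mu)\,d\gamma$ (normalized Haar integral). $\Pi:H^{\kappa+s}_\ell(\mathbb{R}^\kappa,\mathbb{T}^p)\to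 H^{d+s}_\ell(\mathbb{R}^d,\mathbb{Z}_{2,p})$ sends the general $f$ above to the map with components $\mathrm{Re}(a_j(\rho_1^2,\ldots,\rho_p^2,\mu))\rho_j$, $j=1,\ldots,p$ (if $d=p$), or $a_0(\rho_0,\rho_1^2,\ldots,\rho_p^2,\mu)$ followed by $\mathrm{Re}(a_j(\rho_0,\rho_1^2,\ldots,\rho_p^2,\mu))\rho_j$ (if $d=p+1$). $\Psi(0)$ is a fixed column $\mathrm{col}(u_1,\overline{u_1},\ldots,u_p,\overline{u_p})$ if $\kappa=2p$, or $\mathrm{col}(u_0,u_1,\overline{u_1},\ldots,u_p,\overline{u_p})$ if $\kappa=2p+1$, with $u_0\ne0$ real and $u_j\ne0$ complex. (In the paper it is the value at $0$ of the normalized dual basis of the center eigenspace of a scalar retarded equation $\dot z(t)=L_0z_t$ whose spectrum on the imaginary axis consists of the simple eigenvalues $\pm i\omega_1,\ldots,\pm i\omega_p$, together with the simple eigenvalue $0$ if $\kappa=2p+1$; only this form and the nonvanishing of the entries are recorded.) For $\tau=(\tau_1,\ldots,\tau_d)\in\mathbb{R}^d$, $E_\tau$ is the $d\times\kappa$ matrix whose $j$-th row is $(e^{i\omega_1\tau_j},e^{-i\omega_1\tau_j},\ldots,e^{i\omega_p\tau_j},e^{-i\omega_p\tau_j})$, preceded by an entry $1$ if $\kappa=2p+1$. $\mathcal{E}^\ell_\tau:H^{d+s}_\ell(\mathbb{R})\to H^{\kappa+s}_\ell(\mathbb{R}^\kappa)$ is $(\mathcal{E}^\ell_\tau h)(x,\mu)=\Psi(0)\,h(x(E_\tau)^T,\mu)$,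 with $x$ a row vector. *)

theory Defs
  imports "HOL-Analysis.Analysis"
begin

text \<open>
  Conventions. The space \<open>\<real>\<^sup>n\<close> is the topspace of \<^const>\<open>Euclidean_space\<close> \<open>n\<close>: functions
  \<open>nat \<Rightarrow> real\<close> that vanish from index \<open>n\<close> on (so \<open>\<real>\<^sup>0\<close>, i.e. no parameters, is included).
  The parameter \<open>z\<close> is \<open>0\<close> in the case \<open>(d,\<kappa>) = (p,2p)\<close> and \<open>1\<close> in the case
  \<open>(d,\<kappa>) = (p+1,2p+1)\<close>; thus \<open>d = z + p\<close> and \<open>\<kappa> = z + 2p\<close>. All indices start at \<open>0\<close>:
  \<open>\<omega>\<^sub>j\<^sub>+\<^sub>1\<close> is \<open>\<omega> j\<close>, the coordinates \<open>x\<^sub>j\<^sub>+\<^sub>1\<close> and its conjugate are \<open>x (z + 2 * j)\<close> and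
  \<open>x (z + 2 * j + 1)\<close>, and \<open>\<rho>\<^sub>j\<^sub>+\<^sub>1\<close> is \<open>\<rho> (z + j)\<close>, for \<open>j < p\<close>; if \<open>z = 1\<close> the extra coordinates
  \<open>x\<^sub>0\<close>, \<open>\<rho>\<^sub>0\<close> are \<open>x 0\<close>, \<open>\<rho> 0\<close>. Maps are extensional functions of a pair: they are
  \<^const>\<open>undefined\<close> outside their domain, so that equality of maps is equality on the domain.
\<close>

abbreviation real_space :: "nat \<Rightarrow> (nat \<Rightarrow> real) set"
  where "real_space n \<equiv> topspace (Euclidean_space n)"

text \<open>\<open>\<real>\<^sup>\<kappa>\<close> in complex coordinates.\<close>

definition cspace :: "nat \<Rightarrow> nat \<Rightarrow> (nat \<Rightarrow> complex) set"
  where "cspace z p = {x. (\<forall>i<z. x i \<in> \<real>) \<and>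
                          (\<forall>j<p. x (z + 2 * j + 1) = cnj (x (z + 2 * j))) \<and>
                          (\<forall>i\<ge>z + 2 * p. x i = 0)}"

subsection \<open>Polynomials in two groups of variables\<close>

text \<open>Exponents of the monomials of total degree \<open>l\<close> in \<open>n + s\<close> variables.\<close>

definition hom_exps :: "nat \<Rightarrow> nat \<Rightarrow> nat \<Rightarrow> ((nat \<Rightarrow> nat) \<times> (nat \<Rightarrow> nat)) set"
  where "hom_exps n s l = {(\<alpha>, \<beta>). (\<forall>i\<ge>n. \<alpha> i = 0) \<and> (\<forall>i\<ge>s. \<beta> i = 0) \<and>
                                   (\<Sum>i<n. \<alpha> i) + (\<Sum>i<s. \<beta> i) = l}"

text \<open>The first group of variables is real or complex, the parameters \<open>\<mu>\<close> are always real.\<close>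

definition hom_poly :: "nat \<Rightarrow> nat \<Rightarrow> nat \<Rightarrow> ((nat \<Rightarrow> nat) \<times> (nat \<Rightarrow> nat) \<Rightarrow> 'a) \<Rightarrow>
    (nat \<Rightarrow> 'a) \<times> (nat \<Rightarrow> real) \<Rightarrow> 'a::real_normed_field"
  where "hom_poly n s l c = (\<lambda>(x, \<mu>). \<Sum>(\<alpha>, \<beta>) \<in> hom_exps n s l.
           c (\<alpha>, \<beta>) * (\<Prod>i<n. x i ^ \<alpha> i) * (\<Prod>i<s. of_real (\<mu> i) ^ \<beta> i))"

definition poly_funs :: "nat \<Rightarrow> nat \<Rightarrow> ((nat \<Rightarrow> 'a) \<times> (nat \<Rightarrow> real) \<Rightarrow> 'a::real_normed_field) set"
  where "poly_funs n s = {q. \<exists>N c. q = (\<lambda>y. \<Sum>l\<le>N. hom_poly n s l c y)}"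

subsection \<open>The groups\<close>

text \<open>Diagonal of an element of \<open>\<Gamma>\<^sub>0\<close>, continued by \<open>1\<close> beyond index \<open>z + 2p\<close>.\<close>

definition torus_diag :: "nat \<Rightarrow> nat \<Rightarrow> (nat \<Rightarrow> real) \<Rightarrow> nat \<Rightarrow> complex"
  where "torus_diag z p \<theta> = (\<lambda>i. if i < z \<or> i \<ge> z + 2 * p then 1
           else if even (i - z) then cis (\<theta> ((i - z) div 2)) else cis (- \<theta> ((i - z) div 2)))"

definition torus_group :: "nat \<Rightarrow> nat \<Rightarrow> (nat \<Rightarrow> complex) set"
  where "torus_group z p = range (torus_diag z p)"

text \<open>Normalized Haar measure of \<open>\<Gamma>\<^sub>0\<close> in terms of the angles: the product of the
  uniform distributions on \<open>[0,2\<pi>]\<close>.\<close>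

definition angle_measure :: "nat \<Rightarrow> (nat \<Rightarrow> real) measure"
  where "angle_measure p = PiM {..<p} (\<lambda>_. uniform_measure lborel {0..2 * pi})"

definition sign_group :: "nat \<Rightarrow> nat \<Rightarrow> (nat \<Rightarrow> real) set"
  where "sign_group z p = {\<sigma>. (\<forall>i\<in>{z..<z + p}. \<sigma> i \<in> {1, -1}) \<and> (\<forall>i. i \<notin> {z..<z + p} \<longrightarrow> \<sigma> i = 1)}"

text \<open>Action of a diagonal matrix.\<close>

definition dact :: "(nat \<Rightarrow> 'a) \<Rightarrow> (nat \<Rightarrow> 'a) \<Rightarrow> nat \<Rightarrow> 'a::field"
  where "dact \<gamma> x = (\<lambda>i. \<gamma> i * x i)"

subsection \<open>The spaces\<close>

text \<open>\<open>H\<^sup>d\<^sup>+\<^sup>s\<^sub>l(\<real>)\<close>\<close>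

definition Hreal :: "nat \<Rightarrow> nat \<Rightarrow> nat \<Rightarrow> ((nat \<Rightarrow> real) \<times> (nat \<Rightarrow> real) \<Rightarrow> real) set"
  where "Hreal d s l = {restrict (hom_poly d s l c) (real_space d \<times> real_space s) | c. True}"

text \<open>\<open>H\<^sup>\<kappa>\<^sup>+\<^sup>s\<^sub>l(\<real>\<^sup>\<kappa>)\<close>: in complex coordinates a real polynomial map becomes a polynomial in the
  \<open>x\<^sub>j\<close> and their conjugates with complex coefficients whose values lie in the real form.\<close>

definition Hcen :: "nat \<Rightarrow> nat \<Rightarrow> nat \<Rightarrow> nat \<Rightarrow>
    ((nat \<Rightarrow> complex) \<times> (nat \<Rightarrow> real) \<Rightarrow> nat \<Rightarrow> complex) set"
  where "Hcen z p s l = {f \<in> extensional (cspace z p \<times> real_space s).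
           f \<in> cspace z p \<times> real_space s \<rightarrow> cspace z p \<and>
           (\<exists>c. \<forall>x\<in>cspace z p. \<forall>\<mu>\<in>real_space s. \<forall>i<z + 2 * p.
              f (x, \<mu>) i = hom_poly (z + 2 * p) s l (c i) (x, \<mu>))}"

text \<open>\<open>H\<^sup>\<kappa>\<^sup>+\<^sup>s\<^sub>l(\<real>\<^sup>\<kappa>,\<T>\<^sup>p)\<close>\<close>

definition Htor :: "nat \<Rightarrow> nat \<Rightarrow> nat \<Rightarrow> nat \<Rightarrow>
    ((nat \<Rightarrow> complex) \<times> (nat \<Rightarrow> real) \<Rightarrow> nat \<Rightarrow> complex) set"
  where "Htor z p s l = {f \<in> Hcen z p s l. \<forall>\<gamma>\<in>torus_group z p. \<forall>x\<in>cspace z p. \<forall>\<mu>\<in>real_space s.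
           f (dact \<gamma> x, \<mu>) = dact \<gamma> (f (x, \<mu>))}"

text \<open>\<open>H\<^sup>d\<^sup>+\<^sup>s\<^sub>l(\<real>\<^sup>d,\<int>\<^sub>2\<^sub>,\<^sub>p)\<close>\<close>

definition Hsign :: "nat \<Rightarrow> nat \<Rightarrow> nat \<Rightarrow> nat \<Rightarrow>
    ((nat \<Rightarrow> real) \<times> (nat \<Rightarrow> real) \<Rightarrow> nat \<Rightarrow> real) set"
  where "Hsign z p s l = {g \<in> extensional (real_space (z + p) \<times> real_space s).
           g \<in> real_space (z + p) \<times> real_space s \<rightarrow> real_space (z + p) \<and>
           (\<exists>c. \<forall>\<rho>\<in>real_space (z + p). \<forall>\<mu>\<in>real_space s. \<forall>i<z + p.
              g (\<rho>, \<mu>) i = hom_poly (z + p) s l (c i) (\<rho>, \<mu>)) \<and>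
           (\<forall>\<sigma>\<in>sign_group z p. \<forall>\<rho>\<in>real_space (z + p). \<forall>\<mu>\<in>real_space s.
              g (dact \<sigma> \<rho>, \<mu>) = dact \<sigma> (g (\<rho>, \<mu>)))}"

subsection \<open>The maps\<close>

text \<open>\<open>A\<close>\<close>

definition torus_avg :: "nat \<Rightarrow> nat \<Rightarrow> nat \<Rightarrow> nat \<Rightarrow>
    ((nat \<Rightarrow> complex) \<times> (nat \<Rightarrow> real) \<Rightarrow> nat \<Rightarrow> complex) \<Rightarrow>
    (nat \<Rightarrow> complex) \<times> (nat \<Rightarrow> real) \<Rightarrow> nat \<Rightarrow> complex"
  where "torus_avg z p s l = (\<lambda>f\<in>Hcen z p s l.
           restrict (\<lambda>(x, \<mu>). \<lambda>i. LINT \<theta>|angle_measure p.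
               dact (torus_diag z p \<theta>) (f (dact (inverse \<circ> torus_diag z p \<theta>) x, \<mu>)) i)
             (cspace z p \<times> real_space s))"

text \<open>The arguments \<open>x\<^sub>0\<close> (if \<open>z = 1\<close>) and \<open>x\<^sub>j cnj(x\<^sub>j)\<close> of the coefficients of an
  equivariant map, and their counterparts \<open>\<rho>\<^sub>0\<close> and \<open>\<rho>\<^sub>j\<^sup>2\<close>.\<close>

definition torus_invs :: "nat \<Rightarrow> nat \<Rightarrow> (nat \<Rightarrow> complex) \<Rightarrow> nat \<Rightarrow> complex"
  where "torus_invs z p x = (\<lambda>i. if i < z then x i
           else if i < z + p then x (z + 2 * (i - z)) * cnj (x (z + 2 * (i - z))) else 0)"

definition sign_invs :: "nat \<Rightarrow> nat \<Rightarrow> (nat \<Rightarrow> real) \<Rightarrow> nat \<Rightarrow> complex"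
  where "sign_invs z p \<rho> = (\<lambda>i. if i < z then of_real (\<rho> i)
           else if i < z + p then of_real ((\<rho> i)\<^sup>2) else 0)"

text \<open>\<open>a\<close> lists the coefficients in the general form of the equivariant map \<open>f\<close>. The condition
  on \<open>a i\<close> for \<open>i < z\<close> says that \<open>a\<^sub>0\<close> is a real polynomial.\<close>

definition equiv_form :: "nat \<Rightarrow> nat \<Rightarrow> nat \<Rightarrow>
    ((nat \<Rightarrow> complex) \<times> (nat \<Rightarrow> real) \<Rightarrow> nat \<Rightarrow> complex) \<Rightarrow>
    (nat \<Rightarrow> (nat \<Rightarrow> complex) \<times> (nat \<Rightarrow> real) \<Rightarrow> complex) \<Rightarrow> bool"
  where "equiv_form z p s f a \<longleftrightarrow>
           (\<forall>i<z + p. a i \<in> poly_funs (z + p) s) \<and>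
           (\<forall>i<z. \<forall>y \<mu>. a i (\<lambda>k. of_real (y k), \<mu>) \<in> \<real>) \<and>
           (\<forall>x\<in>cspace z p. \<forall>\<mu>\<in>real_space s.
              (\<forall>i<z. f (x, \<mu>) i = a i (torus_invs z p x, \<mu>)) \<and>
              (\<forall>j<p. f (x, \<mu>) (z + 2 * j) = a (z + j) (torus_invs z p x, \<mu>) * x (z + 2 * j) \<and>
                     f (x, \<mu>) (z + 2 * j + 1) = cnj (f (x, \<mu>) (z + 2 * j))))"

definition radial_map :: "nat \<Rightarrow> nat \<Rightarrow> nat \<Rightarrow>
    (nat \<Rightarrow> (nat \<Rightarrow> complex) \<times> (nat \<Rightarrow> real) \<Rightarrow> complex) \<Rightarrow>
    (nat \<Rightarrow> real) \<times> (nat \<Rightarrow> real) \<Rightarrow> nat \<Rightarrow> real"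
  where "radial_map z p s a =
           restrict (\<lambda>(\<rho>, \<mu>). \<lambda>i. if i < z then Re (a i (sign_invs z p \<rho>, \<mu>))
               else if i < z + p then Re (a i (sign_invs z p \<rho>, \<mu>)) * \<rho> i else 0)
             (real_space (z + p) \<times> real_space s)"

text \<open>\<open>\<Pi>\<close>; by \<open>radial_proj_eq\<close> below the result does not depend on the choice of the
  coefficients.\<close>

definition radial_proj :: "nat \<Rightarrow> nat \<Rightarrow> nat \<Rightarrow> nat \<Rightarrow>
    ((nat \<Rightarrow> complex) \<times> (nat \<Rightarrow> real) \<Rightarrow> nat \<Rightarrow> complex) \<Rightarrow>
    (nat \<Rightarrow> real) \<times> (nat \<Rightarrow> real) \<Rightarrow> nat \<Rightarrow> real"
  where "radial_proj z p s l = (\<lambda>f\<in>Htor z p s l. THE g. \<exists>a. equiv_form z p s f a \<and> g = radial_map z p s a)"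

lemma radial_map_apply:
  assumes a: "equiv_form z p s f a" and \<rho>: "\<rho> \<in> real_space (z + p)" and \<mu>: "\<mu> \<in> real_space s"
  defines "x \<equiv> \<lambda>i. if i < z then of_real (\<rho> i)
                   else if i < z + 2 * p then complex_of_real (\<rho> (z + (i - z) div 2)) else 0"
  shows "radial_map z p s a (\<rho>, \<mu>) =
           (\<lambda>i. if i < z then Re (f (x, \<mu>) i)
                else if i < z + p then Re (f (x, \<mu>) (z + 2 * (i - z))) else 0)"
proof -
  have x: "x \<in> cspace z p"
    by (auto simp: cspace_def x_def)
  have inv: "torus_invs z p x = sign_invs z p \<rho>"
    by (rule ext) (auto simp: torus_invs_def sign_invs_def x_def power2_eq_square)
  have eq: "(\<forall>i<z. f (x, \<mu>) i = a i (torus_invs z p x, \<mu>)) \<and>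
      (\<forall>j<p. f (x, \<mu>) (z + 2 * j) = a (z + j) (torus_invs z p x, \<mu>) * x (z + 2 * j))"
    if "x \<in> cspace z p" "\<mu> \<in> real_space s" for x \<mu>
    using a that unfolding equiv_form_def by blast
  have f0: "f (x, \<mu>) i = a i (sign_invs z p \<rho>, \<mu>)" if "i < z" for i
    using eq[OF x \<mu>] that by (simp add: inv)
  have fj: "f (x, \<mu>) (z + 2 * j) = a (z + j) (sign_invs z p \<rho>, \<mu>) * of_real (\<rho> (z + j))"
    if "j < p" for j
  proof -
    have "f (x, \<mu>) (z + 2 * j) = a (z + j) (sign_invs z p \<rho>, \<mu>) * x (z + 2 * j)"
      using eq[OF x \<mu>] that by (simp add: inv)
    then show ?thesis
      using that by (simp add: x_def)
  qed
  show ?thesis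
  proof
    fix i
    show "radial_map z p s a (\<rho>, \<mu>) i =
        (if i < z then Re (f (x, \<mu>) i)
         else if i < z + p then Re (f (x, \<mu>) (z + 2 * (i - z))) else 0)"
      using fj[of "i - z"] \<rho> \<mu> by (auto simp: radial_map_def f0)
  qed
qed

lemma radial_proj_eq:
  assumes "f \<in> Htor z p s l" and a: "equiv_form z p s f a"
  shows "radial_proj z p s l f = radial_map z p s a"
proof -
  have "radial_map z p s b = radial_map z p s a" if b: "equiv_form z p s f b" for b
  proof (rule extensionalityI[of _ "real_space (z + p) \<times> real_space s"])
    fix y assume "y \<in> real_space (z + p) \<times> real_space s"
    then obtain \<rho> \<mu> where y: "y = (\<rho>, \<mu>)" and m: "\<rho> \<in> real_space (z + p)" "\<mu> \<in> real_space s"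
      by blast
    show "radial_map z p s b y = radial_map z p s a y"
      unfolding y radial_map_apply[OF a m] radial_map_apply[OF b m] ..
  qed (simp_all add: radial_map_def)
  then have "(THE g. \<exists>b. equiv_form z p s f b \<and> g = radial_map z p s b) = radial_map z p s a"
    using a by (intro the_equality; blast)
  then show ?thesis
    using assms(1) by (simp add: radial_proj_def)
qed

text \<open>Row \<open>j\<close> of \<open>E\<^sub>\<tau>\<close> is the diagonal of the element of \<open>\<Gamma>\<^sub>0\<close> with angles \<open>\<omega>\<^sub>k \<tau>\<^sub>j\<close>.\<close>

definition delay_matrix :: "nat \<Rightarrow> nat \<Rightarrow> (nat \<Rightarrow> real) \<Rightarrow> (nat \<Rightarrow> real) \<Rightarrow> nat \<Rightarrow> nat \<Rightarrow> complex"
  where "delay_matrix z p \<omega> \<tau> j k = torus_diag z p (\<lambda>m. \<omega> m * \<tau> j) k"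

text \<open>The row vector \<open>x E\<^sub>\<tau>\<^sup>T\<close>; its entries are real for \<open>x\<close> in \<^const>\<open>cspace\<close>, \<^const>\<open>Re\<close> only
  changes the type.\<close>

definition delay_row :: "nat \<Rightarrow> nat \<Rightarrow> (nat \<Rightarrow> real) \<Rightarrow> (nat \<Rightarrow> real) \<Rightarrow> (nat \<Rightarrow> complex) \<Rightarrow> nat \<Rightarrow> real"
  where "delay_row z p \<omega> \<tau> x = (\<lambda>j. if j < z + p
           then Re (\<Sum>k<z + 2 * p. x k * delay_matrix z p \<omega> \<tau> j k) else 0)"

text \<open>\<open>\<E>\<^sup>l\<^sub>\<tau>\<close>, with \<open>\<Psi>\<close> for the column \<open>\<Psi>(0)\<close>.\<close>

definition delay_map :: "nat \<Rightarrow> nat \<Rightarrow> nat \<Rightarrow> nat \<Rightarrow> (nat \<Rightarrow> real) \<Rightarrow> (nat \<Rightarrow> complex) \<Rightarrow> (nat \<Rightarrow> real) \<Rightarrow>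
    ((nat \<Rightarrow> real) \<times> (nat \<Rightarrow> real) \<Rightarrow> real) \<Rightarrow>
    (nat \<Rightarrow> complex) \<times> (nat \<Rightarrow> real) \<Rightarrow> nat \<Rightarrow> complex"
  where "delay_map z p s l \<omega> \<Psi> \<tau> = (\<lambda>h\<in>Hreal (z + p) s l.
           restrict (\<lambda>(x, \<mu>). \<lambda>i. \<Psi> i * of_real (h (delay_row z p \<omega> \<tau> x, \<mu>)))
             (cspace z p \<times> real_space s))"

lemma delay_row_real:
  assumes x: "x \<in> cspace z p" and j: "j < z + p"
  shows "of_real (delay_row z p \<omega> \<tau> x j) = (\<Sum>k<z + 2 * p. x k * delay_matrix z p \<omega> \<tau> j k)"
proof -
  let ?t = "\<lambda>k. x k * delay_matrix z p \<omega> \<tau> j k"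
  have split: "(\<Sum>k<z + 2 * q. ?t k) = (\<Sum>k<z. ?t k) + (\<Sum>k<q. ?t (z + 2 * k) + ?t (z + 2 * k + 1))" for q
    by (induction q) (simp_all add: algebra_simps)
  have "?t k \<in> \<real>" if "k < z" for k
    using x that by (auto simp: cspace_def delay_matrix_def torus_diag_def)
  moreover have "?t (z + 2 * k) + ?t (z + 2 * k + 1) \<in> \<real>" if "k < p" for k
  proof -
    have "?t (z + 2 * k + 1) = cnj (?t (z + 2 * k))"
      using x that by (simp add: cspace_def delay_matrix_def torus_diag_def cis_cnj)
    then show ?thesis by (simp add: complex_is_Real_iff)
  qed
  ultimately have "(\<Sum>k<z + 2 * p. ?t k) \<in> \<real>"
    unfolding split by (intro Reals_add[OF sum_in_Reals sum_in_Reals]) (simp_all only: lessThan_iff)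
  then show ?thesis
    using j by (simp add: delay_row_def del: Re_sum)
qed

end

theory Submission
  imports Defs "HOL-Complex_Analysis.Conformal_Mappings" "HOL-Probability.Probability_Measure"
    "Jordan_Normal_Form.Determinant"
begin

text \<open>
  Sign equivariance means that the \<open>i\<close>-th component of an element of the target only contains
  monomials \<open>\<rho>\<^sup>\<alpha>\<mu>\<^sup>\<beta>\<close> in which \<open>\<rho>\<^sub>i\<close> is the only one of \<open>\<rho>\<^sub>1,\<dots>,\<rho>\<^sub>p\<close> with an odd exponent
  (none of them, if \<open>i = 0\<close> is the extra coordinate). So such a monomial
  determines its component, and we look for as many test polynomials \<open>h\<close> such that the square
  matrix of coefficients of their images is invertible for generic \<open>\<tau>\<close>.

  The matrix only depends on the phases \<open>\<omega>\<^sub>k\<tau>\<^sub>m\<close>. If these phases could be \<open>\<phi>\<^sub>k\<close> or \<open>\<phi>\<^sub>k + \<pi>\<close>,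
  with \<open>e\<^bsup>i\<phi>\<^esup>\<close> cancelling the argument of the \<open>k\<close>-th entry of \<open>\<Psi>(0)\<close> and signs forming an
  invertible matrix, then a fixed linear change of variables would turn the arguments
  of \<open>h\<close> into \<open>\<rho>\<^sub>0\<close> and \<open>2\<rho>\<^sub>k cos(\<phi>\<^sub>k - \<theta>\<^sub>k)\<close>; for monomials in these new
  variables the matrix is diagonal with nonzero entries. By Kronecker's theorem such phases are
  approximated by actual \<open>\<tau>\<close>, so the determinant is not identically zero. Since it extends to an
  entire function on every line, it is nonzero on an open dense set.
\<close>

subsection \<open>Homogeneous polynomials as sums over words\<close>

text \<open>
  A monomial of degree \<open>l\<close> is written as the product along a word of length \<open>l\<close>, where \<open>Inl i\<close>
  stands for the \<open>i\<close>-th variable and \<open>Inr i\<close> for \<open>\<mu> i\<close>. Words are not unique, but they turn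
  substitution of linear forms into distributivity.
\<close>

definition letters :: "nat \<Rightarrow> nat \<Rightarrow> (nat + nat) set"
  where "letters n s = {..<n} <+> {..<s}"

text \<open>Words are extensional, so that there are only finitely many of them and expanding a
  product of sums over letters gives exactly a sum over words.\<close>

definition words :: "nat \<Rightarrow> nat \<Rightarrow> nat \<Rightarrow> (nat \<Rightarrow> nat + nat) set"
  where "words n s l = {..<l} \<rightarrow>\<^sub>E letters n s"

definition val :: "(nat \<Rightarrow> 'a) \<times> (nat \<Rightarrow> real) \<Rightarrow> nat + nat \<Rightarrow> 'a::real_algebra_1"
  where "val y = case_sum (fst y) (\<lambda>i. of_real (snd y i))"

definition occs :: "nat \<Rightarrow> (nat \<Rightarrow> 'a) \<Rightarrow> 'a \<Rightarrow> nat"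
  where "occs l w a = card {t. t < l \<and> w t = a}"

definition word_exp :: "nat \<Rightarrow> (nat \<Rightarrow> nat + nat) \<Rightarrow> (nat \<Rightarrow> nat) \<times> (nat \<Rightarrow> nat)"
  where "word_exp l w = (\<lambda>i. occs l w (Inl i), \<lambda>i. occs l w (Inr i))"

definition monom_at :: "nat \<Rightarrow> nat \<Rightarrow> (nat \<Rightarrow> nat) \<times> (nat \<Rightarrow> nat) \<Rightarrow>
    (nat \<Rightarrow> 'a) \<times> (nat \<Rightarrow> real) \<Rightarrow> 'a::real_normed_field"
  where "monom_at n s e y = (\<Prod>i<n. fst y i ^ fst e i) * (\<Prod>i<s. of_real (snd y i) ^ snd e i)"

lemma val_simps [simp]: "val y (Inl i) = fst y i" "val y (Inr i) = of_real (snd y i)"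
  by (simp_all add: val_def)

lemma finite_letters [simp]: "finite (letters n s)"
  by (simp add: letters_def)

lemma finite_words [simp]: "finite (words n s l)"
  by (simp add: words_def finite_PiE)

lemma word_letter: "w \<in> words n s l \<Longrightarrow> t < l \<Longrightarrow> w t \<in> letters n s"
  by (auto simp: words_def)

lemma sum_letters: "sum f (letters n s) = (\<Sum>i<n. f (Inl i)) + (\<Sum>i<s. f (Inr i))"
  by (simp add: letters_def sum.Plus)

lemma prod_letters: "prod f (letters n s) = (\<Prod>i<n. f (Inl i)) * (\<Prod>i<s. f (Inr i))"
  by (simp add: letters_def prod.Plus)

lemma sum_word:
  fixes f :: "'b \<Rightarrow> 'a::semiring_1"
  assumes "\<And>t. t < l \<Longrightarrow> w t \<in> A" "finite A"
  shows "(\<Sum>t<l. f (w t)) = (\<Sum>a\<in>A. of_nat (occs l w a) * f a)"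
proof -
  have "(\<Sum>t<l. f (w t)) = (\<Sum>a\<in>A. \<Sum>t | t \<in> {..<l} \<and> w t = a. f (w t))"
    using assms by (intro sum.group[symmetric]) auto
  also have "\<dots> = (\<Sum>a\<in>A. of_nat (occs l w a) * f a)"
    by (intro sum.cong) (auto simp: occs_def)
  finally show ?thesis .
qed

lemma prod_word:
  fixes f :: "'b \<Rightarrow> 'a::comm_semiring_1"
  assumes "\<And>t. t < l \<Longrightarrow> w t \<in> A" "finite A"
  shows "(\<Prod>t<l. f (w t)) = (\<Prod>a\<in>A. f a ^ occs l w a)"
proof -
  have "(\<Prod>t<l. f (w t)) = (\<Prod>a\<in>A. \<Prod>t | t \<in> {..<l} \<and> w t = a. f (w t))"
    using assms by (intro prod.group[symmetric]) auto
  also have "\<dots> = (\<Prod>a\<in>A. f a ^ occs l w a)"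
    by (intro prod.cong) (auto simp: occs_def)
  finally show ?thesis .
qed

lemma prod_val_word:
  assumes "w \<in> words n s l"
  shows "(\<Prod>t<l. val y (w t)) = monom_at n s (word_exp l w) y"
  using prod_word[OF word_letter[OF assms] finite_letters, where f = "val y"]
  by (simp add: prod_letters word_exp_def monom_at_def)

lemma word_exp_in_hom_exps:
  assumes "w \<in> words n s l"
  shows "word_exp l w \<in> hom_exps n s l"
proof -
  have "occs l w (Inl i) = 0" if "i \<ge> n" for i
    using word_letter[OF assms] that by (fastforce simp: occs_def letters_def)
  moreover have "occs l w (Inr i) = 0" if "i \<ge> s" for i
    using word_letter[OF assms] that by (fastforce simp: occs_def letters_def)
  moreover have "(\<Sum>t<l. 1::nat) = (\<Sum>a\<in>letters n s. occs l w a)"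
    using sum_word[OF word_letter[OF assms] finite_letters, where f = "\<lambda>_. 1::nat"] by simp
  ultimately show ?thesis
    by (simp add: hom_exps_def word_exp_def sum_letters)
qed

text \<open>List the multiset that contains each letter as often as \<open>e\<close> prescribes; its
  size is the total degree \<open>l\<close>.\<close>

lemma ex_word:
  assumes "e \<in> hom_exps n s l"
  shows "\<exists>w\<in>words n s l. word_exp l w = e"
proof -
  define M where "M = (\<Sum>a\<in>letters n s. replicate_mset (case_sum (fst e) (snd e) a) a)"
  obtain xs where xs: "mset xs = M"
    using ex_mset by blast
  have e: "(\<Sum>i<n. fst e i) + (\<Sum>i<s. snd e i) = l" "\<And>i. i \<ge> n \<Longrightarrow> fst e i = 0" "\<And>i. i \<ge> s \<Longrightarrow> snd e i = 0"
    using assms by (auto simp: hom_exps_def)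
  have cM: "count M a = case_sum (fst e) (snd e) a" for a
  proof -
    have "count M a = (\<Sum>b\<in>letters n s. if b = a then case_sum (fst e) (snd e) b else 0)"
      by (simp add: M_def count_sum)
    also have "\<dots> = (if a \<in> letters n s then case_sum (fst e) (snd e) a else 0)"
      by (subst sum.delta) auto
    also have "\<dots> = case_sum (fst e) (snd e) a"
      using e(2)[of "projl a"] e(3)[of "projr a"] by (cases a) (force simp: letters_def)+
    finally show ?thesis .
  qed
  have "size M = l"
    using e by (simp add: M_def size_multiset_sum sum_letters)
  then have len: "length xs = l"
    using xs size_mset by metis
  define w where "w = restrict ((!) xs) {..<l}"
  have cw: "occs l w a = count M a" for a
  proof -
    have "occs l w a = card {t. t < length xs \<and> xs ! t = a}"
      unfolding occs_def w_def len by (rule arg_cong[where f = card]) auto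
    also have "\<dots> = count (mset xs) a"
      by (simp add: count_mset count_list_eq_length_filter length_filter_conv_card eq_commute)
    finally show ?thesis
      by (simp add: xs)
  qed
  have "xs ! t \<in> letters n s" if "t < l" for t
  proof (rule ccontr)
    assume "xs ! t \<notin> letters n s"
    then have "count M (xs ! t) = 0"
      using e(2)[of "projl (xs ! t)"] e(3)[of "projr (xs ! t)"]
      by (cases "xs ! t") (force simp: cM letters_def)+
    then have "xs ! t \<notin># mset xs"
      by (simp add: xs not_in_iff)
    then show False
      using that len by simp
  qed
  then have "w \<in> words n s l"
    by (auto simp: words_def w_def)
  moreover have "word_exp l w = e"
    by (simp add: word_exp_def cw cM)
  ultimately show ?thesis
    by blast
qed

lemma hom_exps_eq: "hom_exps n s l = word_exp l ` words n s l"
  using ex_word word_exp_in_hom_exps by blast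

lemma finite_hom_exps [simp]: "finite (hom_exps n s l)"
  by (simp add: hom_exps_eq)

lemma hom_poly_eq: "hom_poly n s l c y = (\<Sum>e\<in>hom_exps n s l. c e * monom_at n s e y)"
  by (cases y) (simp add: hom_poly_def monom_at_def case_prod_beta mult.assoc)

lemma sum_words_eq_hom_poly:
  "(\<Sum>w\<in>words n s l. c w * (\<Prod>t<l. val y (w t))) =
     hom_poly n s l (\<lambda>e. \<Sum>w | w \<in> words n s l \<and> word_exp l w = e. c w) y"
proof -
  have "(\<Sum>w\<in>words n s l. c w * (\<Prod>t<l. val y (w t))) =
      (\<Sum>w\<in>words n s l. c w * monom_at n s (word_exp l w) y)"
    by (simp add: prod_val_word)
  also have "\<dots> = (\<Sum>e\<in>hom_exps n s l. \<Sum>w | w \<in> words n s l \<and> word_exp l w = e. c w * monom_at n s (word_exp l w) y)"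
    by (intro sum.group[symmetric]) (auto simp: word_exp_in_hom_exps)
  finally show ?thesis
    by (simp add: hom_poly_eq sum_distrib_right)
qed

text \<open>The coefficient of a monomial is put entirely on one chosen word \<open>W e\<close> with
  these exponents; all other words get coefficient 0.\<close>

lemma hom_poly_eq_sum_words:
  "\<exists>c'. \<forall>y. hom_poly n s l c y = (\<Sum>w\<in>words n s l. c' w * (\<Prod>t<l. val y (w t)))"
proof -
  have "\<forall>e\<in>hom_exps n s l. \<exists>w. w \<in> words n s l \<and> word_exp l w = e"
    using ex_word by blast
  from bchoice[OF this] obtain W where
    W: "\<And>e. e \<in> hom_exps n s l \<Longrightarrow> W e \<in> words n s l \<and> word_exp l (W e) = e"
    by blast
  define c' where "c' = (\<lambda>w. if w = W (word_exp l w) then c (word_exp l w) else 0)"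
  have "(\<Sum>w | w \<in> words n s l \<and> word_exp l w = e. c' w) = c e" if "e \<in> hom_exps n s l" for e
  proof -
    have "(\<Sum>w | w \<in> words n s l \<and> word_exp l w = e. c' w) =
        (\<Sum>w | w \<in> words n s l \<and> word_exp l w = e. if w = W e then c e else 0)"
      by (intro sum.cong) (auto simp: c'_def)
    also have "\<dots> = c e"
      using W[OF that] by (subst sum.delta) auto
    finally show ?thesis .
  qed
  then have "hom_poly n s l c y = (\<Sum>w\<in>words n s l. c' w * (\<Prod>t<l. val y (w t)))" for y
    unfolding sum_words_eq_hom_poly by (simp add: hom_poly_eq)
  then show ?thesis by blast
qed

text \<open>The distributive law: choosing one letter in each factor is choosing a word.\<close>

lemma prod_sum_letters:
  fixes f :: "nat \<Rightarrow> nat + nat \<Rightarrow> 'a::comm_semiring_1"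
  shows "(\<Prod>t<l. \<Sum>a\<in>letters n s. f t a) = (\<Sum>w\<in>words n s l. \<Prod>t<l. f t (w t))"
  unfolding words_def by (subst prod_sum_PiE) auto

lemma prod_sum_words:
  fixes M :: "'b \<Rightarrow> nat + nat \<Rightarrow> 'a::comm_semiring_1"
  shows "(\<Prod>t<l. \<Sum>a\<in>letters n s. M (w t) a * v a) =
     (\<Sum>\<sigma>\<in>words n s l. (\<Prod>t<l. M (w t) (\<sigma> t)) * (\<Prod>t<l. v (\<sigma> t)))"
  by (simp add: prod_sum_letters prod.distrib)

subsection \<open>Characters of the torus\<close>

text \<open>
  The group acts on the coordinate \<open>b\<close> by the character with exponents \<open>weight z b\<close>; a word
  survives averaging in component \<open>i\<close> iff its character is the one of that component.
\<close>

definition weight :: "nat \<Rightarrow> nat + nat \<Rightarrow> nat \<Rightarrow> int"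
  where "weight z b j = (case b of Inl k \<Rightarrow> if k = z + 2 * j then 1 else if k = z + 2 * j + 1 then - 1 else 0
                         | Inr _ \<Rightarrow> 0)"

definition balanced :: "nat \<Rightarrow> nat \<Rightarrow> nat \<Rightarrow> nat \<Rightarrow> (nat \<Rightarrow> nat + nat) \<Rightarrow> bool"
  where "balanced z p l i \<sigma> \<longleftrightarrow> (\<forall>j<p. (\<Sum>t<l. weight z (\<sigma> t) j) = weight z (Inl i) j)"

text \<open>The parameters get the value 1 because the torus does not act on them.\<close>

abbreviation torus_val :: "nat \<Rightarrow> nat \<Rightarrow> (nat \<Rightarrow> real) \<Rightarrow> nat + nat \<Rightarrow> complex"
  where "torus_val z p \<theta> \<equiv> val (torus_diag z p \<theta>, \<lambda>_. 1)"

lemma pair_index_cases: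
  fixes k z p :: nat
  obtains "k < z \<or> k \<ge> z + 2 * p" | m where "m < p" "k = z + 2 * m" | m where "m < p" "k = z + 2 * m + 1"
proof (cases "k < z \<or> k \<ge> z + 2 * p")
  case True
  then show ?thesis using that(1) by blast
next
  case False
  define m where "m = (k - z) div 2"
  have "m < p"
    using False by (auto simp: m_def)
  moreover have "k = z + 2 * m \<or> k = z + 2 * m + 1"
    using False by (auto simp: m_def)
  ultimately show ?thesis using that(2,3) by blast
qed

lemma torus_diag_simps:
  "k < z \<Longrightarrow> torus_diag z p \<theta> k = 1"
  "k \<ge> z + 2 * p \<Longrightarrow> torus_diag z p \<theta> k = 1"
  "j < p \<Longrightarrow> torus_diag z p \<theta> (z + 2 * j) = cis (\<theta> j)"
  "j < p \<Longrightarrow> torus_diag z p \<theta> (Suc (z + 2 * j)) = cis (- \<theta> j)"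
  by (auto simp: torus_diag_def)

lemma weight_simps [simp]:
  "weight z (Inr i) j = 0"
  "k < z \<Longrightarrow> weight z (Inl k) j = 0"
  "weight z (Inl (z + 2 * m)) j = of_bool (m = j)"
  "weight z (Inl (Suc (z + 2 * m))) j = - of_bool (m = j)"
  by (auto simp: weight_def of_bool_def)

lemma cis_sum: "finite A \<Longrightarrow> cis (sum f A) = (\<Prod>i\<in>A. cis (f i))"
  by (induction A rule: finite_induct) (auto simp flip: cis_mult)

lemma torus_val_eq_cis: "torus_val z p \<theta> b = (\<Prod>j<p. cis (of_int (weight z b j) * \<theta> j))"
proof (cases b)
  case (Inl k)
  show ?thesis
  proof (cases rule: pair_index_cases[where k = k and z = z and p = p])
    case 1
    then have "weight z b j = 0" if "j < p" for j
      using that by (auto simp: weight_def Inl)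
    moreover have "torus_diag z p \<theta> k = 1"
      using 1 by (auto simp: torus_diag_def)
    ultimately show ?thesis
      by (simp add: Inl)
  next
    case (2 m)
    have "(\<Prod>j<p. cis (of_int (weight z b j) * \<theta> j)) = (\<Prod>j<p. if m = j then cis (\<theta> j) else 1)"
      by (intro prod.cong) (auto simp: Inl 2)
    then show ?thesis
      using 2 by (simp add: Inl torus_diag_simps)
  next
    case (3 m)
    have "(\<Prod>j<p. cis (of_int (weight z b j) * \<theta> j)) = (\<Prod>j<p. if m = j then cis (- \<theta> j) else 1)"
      by (intro prod.cong) (auto simp: Inl 3)
    then show ?thesis
      using 3 by (simp add: Inl torus_diag_simps)
  qed
qed simp

text \<open>Characters multiply, so their exponents add up along a word.\<close>

lemma torus_word:
  fixes l :: nat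
  shows "(\<Prod>t<l. torus_val z p \<theta> (\<sigma> t)) = (\<Prod>j<p. cis (of_int (\<Sum>t<l. weight z (\<sigma> t) j) * \<theta> j))"
proof -
  have "cis (of_int (\<Sum>t<l. weight z (\<sigma> t) j) * \<theta> j) = (\<Prod>t<l. cis (of_int (weight z (\<sigma> t) j) * \<theta> j))" for j
    unfolding of_int_sum sum_distrib_right by (rule cis_sum) simp
  then show ?thesis
    unfolding torus_val_eq_cis by (subst prod.swap) simp
qed

lemma balanced_torus_word:
  assumes "balanced z p l i \<sigma>"
  shows "(\<Prod>t<l. torus_val z p \<theta> (\<sigma> t)) = torus_diag z p \<theta> i"
proof -
  have "(\<Prod>t<l. torus_val z p \<theta> (\<sigma> t)) = torus_val z p \<theta> (Inl i)"
    unfolding torus_word unfolding torus_val_eq_cis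
    using assms by (intro prod.cong refl) (auto simp: balanced_def)
  then show ?thesis by simp
qed

lemma val_dact: "val (dact \<gamma> x, \<mu>) b = val (\<gamma>, \<lambda>_. 1) b * val (x, \<mu>) b"
  by (cases b) (auto simp: dact_def)

lemma prob_space_uniform_angle: "prob_space (uniform_measure lborel {0..2 * pi})"
  by (rule prob_space_uniform_measure) auto

text \<open>Orthogonality of the characters of the circle: for nonzero \<open>m\<close> the
  primitive \<open>F\<close> takes equal values at \<open>0\<close> and
  \<open>2 * pi\<close>.\<close>

lemma integral_uniform_angle_cis:
  "(LINT x|uniform_measure lborel {0..2 * pi}. cis (of_int m * x)) = of_bool (m = 0)"
proof (cases "m = 0")
  case True
  interpret prob_space "uniform_measure lborel {0..2 * pi}"
    by (rule prob_space_uniform_angle)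
  show ?thesis
    using True prob_space by simp
next
  case False
  have eq: "uniform_measure lborel {0..2 * pi} =
      density lborel (\<lambda>x. ennreal (indicator {0..2 * pi} x / (2 * pi)))"
    unfolding uniform_measure_def
    by (intro arg_cong2[where f = density] ext refl)
      (auto simp: indicator_def divide_ennreal[symmetric])
  define F where "F = (\<lambda>x::real. exp (\<i> * of_int m * of_real x) / (\<i> * of_int m))"
  have F: "(F has_vector_derivative cis (of_int m * x)) (at x within A)" for x A
  proof -
    have "((\<lambda>w. exp (\<i> * of_int m * w) / (\<i> * of_int m)) has_field_derivative
        exp (\<i> * of_int m * of_real x)) (at (of_real x))"
      using False by (auto intro!: derivative_eq_intros)
    from has_vector_derivative_real_field[OF this] show ?thesis
      by (simp add: F_def cis_conv_exp mult.assoc)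
  qed
  have "(LINT x|lborel. indicator {0..2 * pi} x *\<^sub>R cis (of_int m * x)) = F (2 * pi) - F 0"
    by (intro integral_FTC_Icc F) (auto intro!: continuous_intros)
  also have "F (2 * pi) = F 0"
  proof -
    have "exp (\<i> * of_int m * of_real (2 * pi)) = cis (2 * pi * of_int m)"
      by (simp add: cis_conv_exp algebra_simps)
    also have "\<dots> = 1"
      by (rule cis_multiple_2pi) auto
    finally show ?thesis
      by (simp add: F_def)
  qed
  finally have *: "(LINT x|lborel. indicator {0..2 * pi} x *\<^sub>R cis (of_int m * x)) = 0"
    by simp
  have "(LINT x|uniform_measure lborel {0..2 * pi}. cis (of_int m * x)) =
      (LINT x|lborel. (indicator {0..2 * pi} x / (2 * pi)) *\<^sub>R cis (of_int m * x))"
    unfolding eq by (rule integral_density) (auto intro!: borel_measurable_continuous_onI continuous_intros)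
  also have "\<dots> = (LINT x|lborel. (1 / (2 * pi)) *\<^sub>R (indicator {0..2 * pi} x *\<^sub>R cis (of_int m * x)))"
    by (intro Bochner_Integration.integral_cong) auto
  also have "\<dots> = 0"
    unfolding integral_scaleR_right * by simp
  finally show ?thesis
    using False by simp
qed

lemma integrable_uniform_angle_cis: "integrable (uniform_measure lborel {0..2 * pi}) (\<lambda>x. cis (of_int m * x))"
proof -
  interpret prob_space "uniform_measure lborel {0..2 * pi}"
    by (rule prob_space_uniform_angle)
  show ?thesis
  proof (rule integrable_const_bound[where B = 1])
    show "(\<lambda>x. cis (of_int m * x)) \<in> borel_measurable (uniform_measure lborel {0..2 * pi})"
      by (simp add: uniform_measure_def borel_measurable_continuous_onI continuous_intros)
  qed simp
qed

text \<open>The integrand is a product of circle characters with exponents \<open>m j\<close>, the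
  difference between the weight of component \<open>i\<close> and that of the word. The integral
  over the product measure factors, and a factor is 1 or 0 according to whether its exponent
  vanishes.\<close>

lemma integral_torus_word:
  fixes z p l i :: nat and \<sigma> :: "nat \<Rightarrow> nat + nat"
  defines "F \<equiv> \<lambda>\<theta>. torus_diag z p \<theta> i * (\<Prod>t<l. inverse (torus_val z p \<theta> (\<sigma> t)))"
  shows "integrable (angle_measure p) F" (is ?I)
    and "integral\<^sup>L (angle_measure p) F = of_bool (balanced z p l i \<sigma>)" (is ?V)
proof -
  interpret product_sigma_finite "\<lambda>_. uniform_measure lborel {0..2 * pi}"
    by (intro product_sigma_finite.intro prob_space_imp_sigma_finite prob_space_uniform_angle)
  define m where "m = (\<lambda>j. weight z (Inl i) j - (\<Sum>t<l. weight z (\<sigma> t) j))"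
  have F: "F = (\<lambda>\<theta>. \<Prod>j<p. cis (of_int (m j) * \<theta> j))"
  proof
    fix \<theta>
    have "F \<theta> = torus_val z p \<theta> (Inl i) * inverse (\<Prod>t<l. torus_val z p \<theta> (\<sigma> t))"
      by (simp add: F_def prod_inversef[symmetric] comp_def)
    also have "\<dots> = (\<Prod>j<p. cis (of_int (m j) * \<theta> j))"
      unfolding torus_word unfolding torus_val_eq_cis
      by (simp add: m_def prod_inversef[symmetric] comp_def prod.distrib[symmetric] left_diff_distrib
          cis_divide[symmetric] divide_inverse)
    finally show "F \<theta> = (\<Prod>j<p. cis (of_int (m j) * \<theta> j))" .
  qed
  show ?I
    unfolding F angle_measure_def by (intro product_integrable_prod integrable_uniform_angle_cis) auto
  have "integral\<^sup>L (angle_measure p) F = (\<Prod>j<p. of_bool (m j = 0))"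
    unfolding F angle_measure_def
    by (subst product_integral_prod) (auto simp: integrable_uniform_angle_cis integral_uniform_angle_cis)
  also have "\<dots> = of_bool (\<forall>j<p. m j = 0)"
    by (auto simp: of_bool_def prod_zero_iff)
  also have "(\<forall>j<p. m j = 0) \<longleftrightarrow> balanced z p l i \<sigma>"
    by (auto simp: balanced_def m_def)
  finally show ?V .
qed

subsection \<open>Averaging and radial projection\<close>

text \<open>
  \<open>coord\<close> sends \<open>x\<^sub>j\<close> and its conjugate to \<open>\<rho>\<^sub>j\<close>, and \<open>lead\<close> picks \<open>x\<^sub>j\<close> among the two preimages
  of \<open>\<rho>\<^sub>j\<close>.
\<close>

definition coord :: "nat \<Rightarrow> nat \<Rightarrow> nat"
  where "coord z k = (if k < z then k else z + (k - z) div 2)"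

definition lcoord :: "nat \<Rightarrow> nat + nat \<Rightarrow> nat + nat"
  where "lcoord z = map_sum (coord z) id"

definition lead :: "nat \<Rightarrow> nat \<Rightarrow> nat"
  where "lead z i = (if i < z then i else z + 2 * (i - z))"

lemma prod_pairs:
  fixes g :: "nat \<Rightarrow> 'a::comm_monoid_mult"
  shows "(\<Prod>k<z + 2 * p. g k) = (\<Prod>k<z. g k) * (\<Prod>j<p. g (z + 2 * j) * g (Suc (z + 2 * j)))"
  by (induction p) (simp_all add: mult.assoc)

lemma prod_shift:
  fixes g :: "nat \<Rightarrow> 'a::comm_monoid_mult"
  shows "(\<Prod>k<z + p. g k) = (\<Prod>k<z. g k) * (\<Prod>j<p. g (z + j))"
  by (induction p) (simp_all add: mult.assoc)

lemma sum_pairs: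
  fixes g :: "nat \<Rightarrow> 'a::comm_monoid_add"
  shows "(\<Sum>k<z + 2 * p. g k) = (\<Sum>k<z. g k) + (\<Sum>j<p. g (z + 2 * j) + g (Suc (z + 2 * j)))"
  by (induction p) (simp_all add: add.assoc)

lemma weight_lead: "i < z + p \<Longrightarrow> weight z (Inl (lead z i)) j = of_bool (i = z + j)"
  by (auto simp: lead_def)

text \<open>Only the two letters of the pair \<open>j\<close> carry this weight, with opposite
  signs.\<close>

lemma sum_weight_word:
  assumes "\<sigma> \<in> words (z + 2 * p) s l" "j < p"
  shows "(\<Sum>t<l. weight z (\<sigma> t) j) = int (occs l \<sigma> (Inl (z + 2 * j))) - int (occs l \<sigma> (Inl (Suc (z + 2 * j))))"
proof -
  have "(\<Sum>t<l. weight z (\<sigma> t) j) = (\<Sum>a\<in>letters (z + 2 * p) s. int (occs l \<sigma> a) * weight z a j)"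
    by (rule sum_word[OF word_letter[OF assms(1)] finite_letters, where f = "\<lambda>a. weight z a j", simplified])
  also have "\<dots> = int (occs l \<sigma> (Inl (z + 2 * j))) - int (occs l \<sigma> (Inl (Suc (z + 2 * j))))"
    using assms(2)
    by (simp add: sum_letters sum_pairs sum_subtractf of_bool_def if_distrib[of "(*) _"] cong: if_cong)
  finally show ?thesis .
qed

lemma balanced_lead_iff:
  assumes "\<sigma> \<in> words (z + 2 * p) s l" "i < z + p"
  shows "balanced z p l (lead z i) \<sigma> \<longleftrightarrow>
     (\<forall>j<p. occs l \<sigma> (Inl (z + 2 * j)) = occs l \<sigma> (Inl (Suc (z + 2 * j))) + of_bool (i = z + j))"
proof -
  have "int a - int b = of_bool P \<longleftrightarrow> a = b + of_bool P" for a b P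
    by auto
  then show ?thesis
    unfolding balanced_def by (simp add: sum_weight_word[OF assms(1)] weight_lead[OF assms(2)])
qed

text \<open>Members of \<open>poly_funs\<close> use one coefficient function for all degrees. A
  single \<open>c\<close> can serve, since an exponent pair determines its degree.\<close>

lemma finite_sum_monom_in_poly_funs:
  assumes "finite S" and e: "\<And>\<sigma>. \<sigma> \<in> S \<Longrightarrow> e \<sigma> \<in> hom_exps n s (deg \<sigma>)"
  shows "(\<lambda>y. \<Sum>\<sigma>\<in>S. K \<sigma> * monom_at n s (e \<sigma>) y) \<in> poly_funs n s"
proof -
  \<comment> \<open>The sum of the degrees is a crude common bound for them.\<close>
  define N where "N = sum deg S"
  define c where "c = (\<lambda>e'. \<Sum>\<sigma>\<in>S. if e' = e \<sigma> then K \<sigma> else 0)"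
  have uniq: "e \<sigma> \<in> hom_exps n s m \<longleftrightarrow> m = deg \<sigma>" if "\<sigma> \<in> S" for \<sigma> m
    using e[OF that] by (auto simp: hom_exps_def)
  have "(\<Sum>m\<le>N. hom_poly n s m c y) = (\<Sum>\<sigma>\<in>S. K \<sigma> * monom_at n s (e \<sigma>) y)" for y
  proof -
    have "hom_poly n s m c y = (\<Sum>\<sigma>\<in>S. if m = deg \<sigma> then K \<sigma> * monom_at n s (e \<sigma>) y else 0)" for m
    proof -
      have "hom_poly n s m c y =
          (\<Sum>\<sigma>\<in>S. \<Sum>e'\<in>hom_exps n s m. if e' = e \<sigma> then K \<sigma> * monom_at n s (e \<sigma>) y else 0)"
        unfolding hom_poly_eq c_def sum_distrib_right by (subst sum.swap) (auto intro!: sum.cong)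
      also have "\<dots> = (\<Sum>\<sigma>\<in>S. if m = deg \<sigma> then K \<sigma> * monom_at n s (e \<sigma>) y else 0)"
        by (intro sum.cong refl) (simp add: uniq)
      finally show ?thesis .
    qed
    moreover have "deg \<sigma> \<le> N" if "\<sigma> \<in> S" for \<sigma>
      unfolding N_def using that assms(1) by (intro member_le_sum) auto
    ultimately show ?thesis
      by simp (subst sum.swap, auto intro!: sum.cong)
  qed
  then show ?thesis
    unfolding poly_funs_def by (intro CollectI exI[of _ N] exI[of _ c]) auto
qed

section \<open>Averages of maps given by word coefficients\<close>

lemma inverse_torus_diag: "inverse \<circ> torus_diag z p \<theta> = torus_diag z p (\<lambda>j. - \<theta> j)"
  by (auto simp: torus_diag_def fun_eq_iff)

lemma torus_diag_cspace:
  assumes "x \<in> cspace z p"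
  shows "dact (torus_diag z p \<theta>) x \<in> cspace z p"
  using assms by (auto simp: cspace_def dact_def torus_diag_def cis_cnj)

lemma torus_val_inverse: "val (inverse \<circ> torus_diag z p \<theta>, \<lambda>_. 1) b = inverse (torus_val z p \<theta> b)"
  by (cases b) auto

text \<open>The shape of the images of the delay map: a fixed column \<open>\<Psi>\<close> times one
  scalar polynomial with word coefficients \<open>C\<close>. Averages and projections are computed
  from these data.\<close>

locale word_map =
  fixes z p s l :: nat and \<Psi> :: "nat \<Rightarrow> complex" and C :: "(nat \<Rightarrow> nat + nat) \<Rightarrow> complex"
    and f :: "(nat \<Rightarrow> complex) \<times> (nat \<Rightarrow> real) \<Rightarrow> nat \<Rightarrow> complex"
  assumes f_ext: "f \<in> extensional (cspace z p \<times> real_space s)"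
    and f_cspace: "f \<in> cspace z p \<times> real_space s \<rightarrow> cspace z p"
    and f_eq: "\<And>x \<mu> i. x \<in> cspace z p \<Longrightarrow> \<mu> \<in> real_space s \<Longrightarrow>
      f (x, \<mu>) i = \<Psi> i * (\<Sum>\<sigma>\<in>words (z + 2 * p) s l. C \<sigma> * (\<Prod>t<l. val (x, \<mu>) (\<sigma> t)))"
begin

lemma f_Hcen: "f \<in> Hcen z p s l"
proof -
  have "f (x, \<mu>) i = hom_poly (z + 2 * p) s l
      (\<lambda>e. \<Sum>w | w \<in> words (z + 2 * p) s l \<and> word_exp l w = e. \<Psi> i * C w) (x, \<mu>)"
    if "x \<in> cspace z p" "\<mu> \<in> real_space s" for x \<mu> i
    using that by (simp add: f_eq sum_distrib_left mult.assoc flip: sum_words_eq_hom_poly)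
  then have "\<exists>c. \<forall>x\<in>cspace z p. \<forall>\<mu>\<in>real_space s. \<forall>i<z + 2 * p.
      f (x, \<mu>) i = hom_poly (z + 2 * p) s l (c i) (x, \<mu>)"
    by (intro exI[of _ "\<lambda>i e. \<Sum>w | w \<in> words (z + 2 * p) s l \<and> word_exp l w = e. \<Psi> i * C w"]) blast
  then show ?thesis
    using f_ext f_cspace by (simp add: Hcen_def)
qed

abbreviation "rotated \<theta> x \<mu> \<equiv> dact (torus_diag z p \<theta>) (f (dact (inverse \<circ> torus_diag z p \<theta>) x, \<mu>))"

lemma rotated_cspace:
  assumes "x \<in> cspace z p" "\<mu> \<in> real_space s"
  shows "rotated \<theta> x \<mu> \<in> cspace z p"
  unfolding inverse_torus_diag using assms f_cspace torus_diag_cspace by (metis PiE SigmaI)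

lemma torus_avg_apply:
  assumes "x \<in> cspace z p" "\<mu> \<in> real_space s"
  shows "torus_avg z p s l f (x, \<mu>) i = (LINT \<theta>|angle_measure p. rotated \<theta> x \<mu> i)"
  using assms f_Hcen by (simp add: torus_avg_def)

text \<open>Rotation multiplies each word by the inverse of its character and component
  \<open>i\<close> by the character of that component; integration keeps exactly the balanced
  words.\<close>

lemma torus_avg_eq:
  assumes "x \<in> cspace z p" "\<mu> \<in> real_space s"
  shows "torus_avg z p s l f (x, \<mu>) i =
    \<Psi> i * (\<Sum>\<sigma> | \<sigma> \<in> words (z + 2 * p) s l \<and> balanced z p l i \<sigma>. C \<sigma> * (\<Prod>t<l. val (x, \<mu>) (\<sigma> t)))"
proof -
  define F where "F = (\<lambda>\<sigma> \<theta>. torus_diag z p \<theta> i * (\<Prod>t<l. inverse (torus_val z p \<theta> (\<sigma> t))))"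
  have "rotated \<theta> x \<mu> i = (\<Sum>\<sigma>\<in>words (z + 2 * p) s l. \<Psi> i * (C \<sigma> * (\<Prod>t<l. val (x, \<mu>) (\<sigma> t))) * F \<sigma> \<theta>)" for \<theta>
  proof -
    have "dact (inverse \<circ> torus_diag z p \<theta>) x \<in> cspace z p"
      unfolding inverse_torus_diag by (intro torus_diag_cspace assms)
    then show ?thesis
      using assms(2) unfolding dact_def[of _ "f _"] F_def
      by (simp add: f_eq val_dact torus_val_inverse prod.distrib sum_distrib_left mult_ac)
  qed
  moreover have F: "integrable (angle_measure p) (F \<sigma>)"
    "integral\<^sup>L (angle_measure p) (F \<sigma>) = of_bool (balanced z p l i \<sigma>)" for \<sigma>
    unfolding F_def by (rule integral_torus_word)+
  ultimately have "torus_avg z p s l f (x, \<mu>) i =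
      (\<Sum>\<sigma>\<in>words (z + 2 * p) s l. \<Psi> i * (C \<sigma> * (\<Prod>t<l. val (x, \<mu>) (\<sigma> t))) * of_bool (balanced z p l i \<sigma>))"
    unfolding torus_avg_apply[OF assms] by (simp add: F)
  also have "\<dots> = (\<Sum>\<sigma> | \<sigma> \<in> words (z + 2 * p) s l \<and> balanced z p l i \<sigma>.
      \<Psi> i * (C \<sigma> * (\<Prod>t<l. val (x, \<mu>) (\<sigma> t))))"
    by (intro sum.mono_neutral_cong_right) auto
  finally show ?thesis
    by (simp add: sum_distrib_left)
qed

text \<open>The conditions defining \<open>cspace\<close> hold for each rotated vector and pass
  through the integral, which commutes with conjugation.\<close>

lemma torus_avg_cspace:
  assumes "x \<in> cspace z p" "\<mu> \<in> real_space s"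
  shows "torus_avg z p s l f (x, \<mu>) \<in> cspace z p"
proof -
  note r = rotated_cspace[OF assms, unfolded cspace_def]
  have "torus_avg z p s l f (x, \<mu>) i \<in> \<real>" if "i < z" for i
  proof -
    have "cnj (rotated \<theta> x \<mu> i) = rotated \<theta> x \<mu> i" for \<theta>
      using r that by (auto simp: Reals_cnj_iff)
    then show ?thesis
      unfolding torus_avg_apply[OF assms] Reals_cnj_iff
      by (metis (no_types, lifting) Bochner_Integration.integral_cong Bochner_Integration.integral_cnj)
  qed
  moreover have "torus_avg z p s l f (x, \<mu>) (z + 2 * j + 1) = cnj (torus_avg z p s l f (x, \<mu>) (z + 2 * j))"
    if "j < p" for j
    using r that unfolding torus_avg_apply[OF assms] by simp
  moreover have "torus_avg z p s l f (x, \<mu>) i = 0" if "i \<ge> z + 2 * p" for i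
    using r that unfolding torus_avg_apply[OF assms] by simp
  ultimately show ?thesis
    by (simp add: cspace_def)
qed

lemma torus_avg_ext: "torus_avg z p s l f \<in> extensional (cspace z p \<times> real_space s)"
  using f_Hcen by (simp add: torus_avg_def)

text \<open>On the words left after averaging, rotation acts by the character of component
  \<open>i\<close>, which gives equivariance.\<close>

lemma torus_avg_Htor: "torus_avg z p s l f \<in> Htor z p s l"
proof -
  have "torus_avg z p s l f (x, \<mu>) i = hom_poly (z + 2 * p) s l
      (\<lambda>e. \<Sum>w | w \<in> words (z + 2 * p) s l \<and> word_exp l w = e. of_bool (balanced z p l i w) * (\<Psi> i * C w)) (x, \<mu>)"
    if "x \<in> cspace z p" "\<mu> \<in> real_space s" for x \<mu> i
    using that unfolding torus_avg_eq[OF that] sum_distrib_left sum_words_eq_hom_poly[symmetric]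
    by (intro sum.mono_neutral_cong_left) auto
  then have "\<exists>c. \<forall>x\<in>cspace z p. \<forall>\<mu>\<in>real_space s. \<forall>i<z + 2 * p.
      torus_avg z p s l f (x, \<mu>) i = hom_poly (z + 2 * p) s l (c i) (x, \<mu>)"
    by (intro exI[of _ "\<lambda>i e. \<Sum>w | w \<in> words (z + 2 * p) s l \<and> word_exp l w = e. of_bool (balanced z p l i w) * (\<Psi> i * C w)"]) blast
  then have "torus_avg z p s l f \<in> Hcen z p s l"
    using torus_avg_ext torus_avg_cspace by (auto simp: Hcen_def)
  moreover have "torus_avg z p s l f (dact (torus_diag z p \<theta>) x, \<mu>) = dact (torus_diag z p \<theta>) (torus_avg z p s l f (x, \<mu>))"
    if "x \<in> cspace z p" "\<mu> \<in> real_space s" for \<theta> x \<mu>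
  proof
    fix i
    show "torus_avg z p s l f (dact (torus_diag z p \<theta>) x, \<mu>) i = dact (torus_diag z p \<theta>) (torus_avg z p s l f (x, \<mu>)) i"
      using that unfolding torus_avg_eq[OF torus_diag_cspace[OF that(1)] that(2)] dact_def[of _ "torus_avg _ _ _ _ _ _"]
      by (auto simp: torus_avg_eq val_dact prod.distrib balanced_torus_word sum_distrib_left mult_ac intro!: sum.cong)
  qed
  ultimately show ?thesis
    by (auto simp: Htor_def torus_group_def)
qed

text \<open>In a word balanced for \<open>lead z i\<close> each conjugate variable has a partner,
  and at most one variable is left over. So the number of conjugate letters, those at
  \<open>Suc (z + 2 * (k - z))\<close>, is the exponent of the invariant.\<close>

definition inv_exp :: "(nat \<Rightarrow> nat + nat) \<Rightarrow> (nat \<Rightarrow> nat) \<times> (nat \<Rightarrow> nat)"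
  where "inv_exp \<sigma> = (\<lambda>k. occs l \<sigma> (Inl (if k < z then k else Suc (z + 2 * (k - z)))), \<lambda>b. occs l \<sigma> (Inr b))"

text \<open>
  For \<open>i < z\<close> the real part does not change the values on \<^const>\<open>cspace\<close>, and makes the
  coefficient function real on all real arguments, as required by \<^const>\<open>equiv_form\<close>.
\<close>

definition inv_coeff :: "nat \<Rightarrow> (nat \<Rightarrow> nat + nat) \<Rightarrow> complex"
  where "inv_coeff i \<sigma> = (if i < z then of_real (Re (\<Psi> i * C \<sigma>)) else \<Psi> (lead z i) * C \<sigma>)"

definition inv_fun :: "nat \<Rightarrow> (nat \<Rightarrow> complex) \<times> (nat \<Rightarrow> real) \<Rightarrow> complex"
  where "inv_fun i y = (\<Sum>\<sigma> | \<sigma> \<in> words (z + 2 * p) s l \<and> balanced z p l (lead z i) \<sigma>.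
           inv_coeff i \<sigma> * monom_at (z + p) s (inv_exp \<sigma>) y)"

text \<open>Pairing each conjugate with its partner yields the invariants, with one factor
  \<open>x (lead z i)\<close> left over when \<open>i \<ge> z\<close>.\<close>

lemma prod_val_balanced:
  assumes "\<sigma> \<in> words (z + 2 * p) s l" "i < z + p" "balanced z p l (lead z i) \<sigma>" "x \<in> cspace z p"
  shows "(\<Prod>t<l. val (x, \<mu>) (\<sigma> t)) =
    monom_at (z + p) s (inv_exp \<sigma>) (torus_invs z p x, \<mu>) * (if i < z then 1 else x (lead z i))"
proof -
  let ?o = "\<lambda>j. occs l \<sigma> (Inl (Suc (z + 2 * j)))"
  have o: "occs l \<sigma> (Inl (z + 2 * j)) = ?o j + of_bool (i = z + j)" if "j < p" for j
    using assms that by (simp add: balanced_lead_iff)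
  have "(\<Prod>t<l. val (x, \<mu>) (\<sigma> t)) = (\<Prod>k<z. x k ^ occs l \<sigma> (Inl k)) *
      (\<Prod>j<p. x (z + 2 * j) ^ occs l \<sigma> (Inl (z + 2 * j)) * x (Suc (z + 2 * j)) ^ ?o j) *
      (\<Prod>b<s. of_real (\<mu> b) ^ occs l \<sigma> (Inr b))"
    by (simp add: prod_val_word[OF assms(1)] monom_at_def word_exp_def prod_pairs)
  also have "(\<Prod>j<p. x (z + 2 * j) ^ occs l \<sigma> (Inl (z + 2 * j)) * x (Suc (z + 2 * j)) ^ ?o j) =
      (\<Prod>j<p. (x (z + 2 * j) * cnj (x (z + 2 * j))) ^ ?o j * (if i = z + j then x (z + 2 * j) else 1))"
    using assms(4) by (intro prod.cong) (auto simp: o cspace_def power_mult_distrib)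
  also have "\<dots> = (\<Prod>j<p. (x (z + 2 * j) * cnj (x (z + 2 * j))) ^ ?o j) * (\<Prod>j<p. if i = z + j then x (z + 2 * j) else 1)"
    by (rule prod.distrib)
  also have "(\<Prod>j<p. if i = z + j then x (z + 2 * j) else 1) = (if i < z then 1 else x (lead z i))"
  proof (cases "i < z")
    case False
    then have "(\<Prod>j<p. if i = z + j then x (z + 2 * j) else 1) = (\<Prod>j<p. if j = i - z then x (z + 2 * j) else 1)"
      by (intro prod.cong) auto
    then show ?thesis
      using False assms(2) by (simp add: lead_def)
  qed auto
  finally show ?thesis
    by (simp add: monom_at_def prod_shift inv_exp_def torus_invs_def mult_ac)
qed

lemma inv_fun_poly: "inv_fun i \<in> poly_funs (z + p) s"
proof -
  \<comment> \<open>The paired invariants are quadratic in \<open>x\<close>, so the degree of the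
    new monomial depends on the word.\<close>
  define deg where "deg = (\<lambda>\<sigma>. sum (fst (inv_exp \<sigma>)) {..<z + p} + sum (snd (inv_exp \<sigma>)) {..<s})"
  have "inv_exp \<sigma> \<in> hom_exps (z + p) s (deg \<sigma>)" if "\<sigma> \<in> words (z + 2 * p) s l" for \<sigma>
  proof -
    have "occs l \<sigma> (Inl (if k < z then k else Suc (z + 2 * (k - z)))) = 0" if "k \<ge> z + p" for k
      using word_letter[OF \<open>\<sigma> \<in> _\<close>] that by (fastforce simp: occs_def letters_def)
    moreover have "occs l \<sigma> (Inr k) = 0" if "k \<ge> s" for k
      using word_letter[OF \<open>\<sigma> \<in> _\<close>] that by (fastforce simp: occs_def letters_def)
    ultimately show ?thesis
      unfolding hom_exps_def deg_def by (simp add: inv_exp_def)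
  qed
  then show ?thesis
    unfolding inv_fun_def[abs_def] by (intro finite_sum_monom_in_poly_funs[where deg = deg]) auto
qed

lemma monom_at_of_real:
  "monom_at n s e (\<lambda>k. of_real (y k), \<mu>) = (of_real (monom_at n s e (y, \<mu>)) :: complex)"
  by (simp add: monom_at_def)

lemma equiv_form_torus_avg: "equiv_form z p s (torus_avg z p s l f) inv_fun"
proof -
  have "inv_fun i (\<lambda>k. of_real (y k), \<mu>) \<in> \<real>" if "i < z" for i y \<mu>
    using that by (auto simp: inv_fun_def inv_coeff_def monom_at_of_real intro!: sum_in_Reals)
  moreover have "torus_avg z p s l f (x, \<mu>) i = inv_fun i (torus_invs z p x, \<mu>)"
    if "i < z" "x \<in> cspace z p" "\<mu> \<in> real_space s" for i x \<mu>
  proof -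
    \<comment> \<open>On \<open>cspace\<close> all invariants are real, so every monomial in them is
      a real number \<open>m \<sigma>\<close> and taking real parts changes only the
      coefficients.\<close>
    have inv: "torus_invs z p x = (\<lambda>k. of_real (Re (torus_invs z p x k)))"
      using that(2) by (auto simp: torus_invs_def cspace_def fun_eq_iff complex_is_Real_iff complex_eq_iff)
    define m where "m = (\<lambda>\<sigma>. monom_at (z + p) s (inv_exp \<sigma>) (\<lambda>k. Re (torus_invs z p x k), \<mu>))"
    have m: "monom_at (z + p) s (inv_exp \<sigma>) (torus_invs z p x, \<mu>) = of_real (m \<sigma>)" for \<sigma>
      by (subst inv) (simp only: monom_at_of_real m_def)
    have lead: "lead z i = i"
      using that by (simp add: lead_def)
    have "torus_avg z p s l f (x, \<mu>) i \<in> \<real>"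
      using torus_avg_cspace[OF that(2,3)] that(1) by (simp add: cspace_def)
    then have 1: "torus_avg z p s l f (x, \<mu>) i = of_real (Re (torus_avg z p s l f (x, \<mu>) i))"
      by simp
    have 2: "torus_avg z p s l f (x, \<mu>) i = (\<Sum>\<sigma> | \<sigma> \<in> words (z + 2 * p) s l \<and> balanced z p l i \<sigma>.
        \<Psi> i * C \<sigma> * of_real (m \<sigma>))"
      unfolding torus_avg_eq[OF that(2,3)] sum_distrib_left
      using that prod_val_balanced[of _ i x \<mu>] by (intro sum.cong refl) (auto simp: lead m)
    have "Re (torus_avg z p s l f (x, \<mu>) i) =
        (\<Sum>\<sigma> | \<sigma> \<in> words (z + 2 * p) s l \<and> balanced z p l i \<sigma>. Re (\<Psi> i * C \<sigma>) * m \<sigma>)"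
      unfolding 2 by simp
    with 1 show ?thesis
      using that(1) by (simp add: inv_fun_def inv_coeff_def m lead)
  qed
  moreover have "torus_avg z p s l f (x, \<mu>) (z + 2 * j) = inv_fun (z + j) (torus_invs z p x, \<mu>) * x (z + 2 * j)"
    if "j < p" "x \<in> cspace z p" "\<mu> \<in> real_space s" for j x \<mu>
  proof -
    have lead: "lead z (z + j) = z + 2 * j"
      by (simp add: lead_def)
    show ?thesis
      unfolding torus_avg_eq[OF that(2,3)] inv_fun_def inv_coeff_def lead sum_distrib_left sum_distrib_right
      using that prod_val_balanced[of _ "z + j" x \<mu>] by (intro sum.cong refl) (auto simp: lead)
  qed
  moreover have "torus_avg z p s l f (x, \<mu>) (z + 2 * j + 1) = cnj (torus_avg z p s l f (x, \<mu>) (z + 2 * j))"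
    if "j < p" "x \<in> cspace z p" "\<mu> \<in> real_space s" for j x \<mu>
    using torus_avg_cspace[OF that(2,3)] that(1) by (simp add: cspace_def)
  ultimately show ?thesis
    unfolding equiv_form_def using inv_fun_poly by blast
qed

text \<open>The projection reads off the averaged map at the point whose paired coordinates both
  equal the corresponding \<open>\<rho>\<close>; there each letter has the value of its image under
  \<open>lcoord\<close>.\<close>

lemma radial_proj_apply:
  assumes "\<rho> \<in> real_space (z + p)" "\<mu> \<in> real_space s"
  shows "radial_proj z p s l (torus_avg z p s l f) (\<rho>, \<mu>) i = (if i < z + p then
    \<Sum>\<sigma> | \<sigma> \<in> words (z + 2 * p) s l \<and> balanced z p l (lead z i) \<sigma>.
      Re (\<Psi> (lead z i) * C \<sigma>) * (\<Prod>t<l. val (\<rho>, \<mu>) (lcoord z (\<sigma> t))) else 0)"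
proof -
  define x where "x = (\<lambda>i. if i < z then of_real (\<rho> i)
                   else if i < z + 2 * p then complex_of_real (\<rho> (z + (i - z) div 2)) else 0)"
  have x: "x \<in> cspace z p"
    by (auto simp: cspace_def x_def)
  have val: "val (x, \<mu>) b = of_real (val (\<rho>, \<mu>) (lcoord z b))" if "b \<in> letters (z + 2 * p) s" for b
    using that by (auto simp: letters_def x_def lcoord_def coord_def)
  have "torus_avg z p s l f (x, \<mu>) (lead z i) = (\<Sum>\<sigma> | \<sigma> \<in> words (z + 2 * p) s l \<and> balanced z p l (lead z i) \<sigma>.
      \<Psi> (lead z i) * C \<sigma> * of_real (\<Prod>t<l. val (\<rho>, \<mu>) (lcoord z (\<sigma> t))))"
    unfolding torus_avg_eq[OF x assms(2)] sum_distrib_left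
    by (intro sum.cong refl) (auto simp: val word_letter)
  then have "Re (torus_avg z p s l f (x, \<mu>) (lead z i)) =
     (\<Sum>\<sigma> | \<sigma> \<in> words (z + 2 * p) s l \<and> balanced z p l (lead z i) \<sigma>.
      Re (\<Psi> (lead z i) * C \<sigma>) * (\<Prod>t<l. val (\<rho>, \<mu>) (lcoord z (\<sigma> t))))"
    by (simp del: of_real_prod)
  then show ?thesis
    unfolding radial_proj_eq[OF torus_avg_Htor equiv_form_torus_avg]
      radial_map_apply[OF equiv_form_torus_avg assms, folded x_def]
    by (auto simp: lead_def)
qed

lemma radial_proj_ext:
  "radial_proj z p s l (torus_avg z p s l f) \<in> extensional (real_space (z + p) \<times> real_space s)"
  unfolding radial_proj_eq[OF torus_avg_Htor equiv_form_torus_avg] by (simp add: radial_map_def)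

end

subsection \<open>Sign equivariant maps\<close>

definition proj_exp :: "nat \<Rightarrow> nat \<Rightarrow> (nat \<Rightarrow> nat + nat) \<Rightarrow> (nat \<Rightarrow> nat) \<times> (nat \<Rightarrow> nat)"
  where "proj_exp z l \<sigma> = word_exp l (\<lambda>t. lcoord z (\<sigma> t))"

text \<open>If \<open>i < z\<close>, then \<open>i = z + j\<close> never holds and all these
  exponents must be even.\<close>

definition odd_type :: "nat \<Rightarrow> nat \<Rightarrow> nat \<Rightarrow> (nat \<Rightarrow> nat) \<times> (nat \<Rightarrow> nat) \<Rightarrow> bool"
  where "odd_type z p i e \<longleftrightarrow> (\<forall>j<p. odd (fst e (z + j)) \<longleftrightarrow> i = z + j)"

lemma lcoord_letters: "b \<in> letters (z + 2 * p) s \<Longrightarrow> lcoord z b \<in> letters (z + p) s"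
  by (auto simp: letters_def lcoord_def coord_def)

lemma lcoord_word: "\<sigma> \<in> words (z + 2 * p) s l \<Longrightarrow> restrict (\<lambda>t. lcoord z (\<sigma> t)) {..<l} \<in> words (z + p) s l"
  using lcoord_letters word_letter by (auto simp: words_def)

lemma word_exp_restrict: "word_exp l (restrict w {..<l}) = word_exp l w"
  by (auto simp: word_exp_def occs_def fun_eq_iff intro!: arg_cong[where f = card])

lemma proj_exp_in_hom_exps: "\<sigma> \<in> words (z + 2 * p) s l \<Longrightarrow> proj_exp z l \<sigma> \<in> hom_exps (z + p) s l"
  using word_exp_in_hom_exps[OF lcoord_word] by (simp add: word_exp_restrict proj_exp_def)

lemma prod_val_lcoord:
  assumes "\<sigma> \<in> words (z + 2 * p) s l"
  shows "(\<Prod>t<l. val y (lcoord z (\<sigma> t))) = monom_at (z + p) s (proj_exp z l \<sigma>) y"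
  using prod_val_word[OF lcoord_word[OF assms], of y] by (simp add: word_exp_restrict proj_exp_def)

lemma fst_proj_exp: "fst (proj_exp z l \<sigma>) (z + j) = occs l \<sigma> (Inl (z + 2 * j)) + occs l \<sigma> (Inl (Suc (z + 2 * j)))"
proof -
  have "lcoord z b = Inl (z + j) \<longleftrightarrow> b = Inl (z + 2 * j) \<or> b = Inl (Suc (z + 2 * j))" for b
    by (cases b) (auto simp: lcoord_def coord_def)
  then have "{t. t < l \<and> lcoord z (\<sigma> t) = Inl (z + j)} =
      {t. t < l \<and> \<sigma> t = Inl (z + 2 * j)} \<union> {t. t < l \<and> \<sigma> t = Inl (Suc (z + 2 * j))}"
    by auto
  then show ?thesis
    unfolding proj_exp_def word_exp_def occs_def fst_conv by (simp add: card_Un_disjoint disjoint_iff)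
qed

text \<open>The two letters over \<open>z + j\<close> occur together twice as often as the conjugate
  one, plus once more if \<open>i = z + j\<close>.\<close>

lemma balanced_odd_type:
  assumes "\<sigma> \<in> words (z + 2 * p) s l" "i < z + p" "balanced z p l (lead z i) \<sigma>"
  shows "odd_type z p i (proj_exp z l \<sigma>)"
  using assms by (auto simp: odd_type_def fst_proj_exp balanced_lead_iff)

text \<open>A sign change is the torus element with angles \<open>0\<close> and \<open>pi\<close>,
  so sign equivariance is inherited from the character of a balanced word.\<close>

lemma sign_balanced_word:
  assumes sg: "sg \<in> sign_group z p" and \<sigma>: "\<sigma> \<in> words (z + 2 * p) s l" "i < z + p" "balanced z p l (lead z i) \<sigma>"
  shows "(\<Prod>t<l. val (sg, \<lambda>_. 1) (lcoord z (\<sigma> t))) = sg i"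
proof -
  define \<theta> where "\<theta> = (\<lambda>j. if sg (z + j) = 1 then 0 else pi)"
  have sg1: "sg k = 1" if "k < z" for k
    using sg that by (auto simp: sign_group_def)
  have sg2: "sg (z + j) = 1 \<or> sg (z + j) = -1" if "j < p" for j
    using sg that by (auto simp: sign_group_def)
  have diag: "torus_diag z p \<theta> k = of_real (sg (coord z k))" if "k < z + 2 * p" for k
  proof (cases rule: pair_index_cases[where k = k and z = z and p = p])
    case 1
    then show ?thesis
      using that sg1 by (auto simp: torus_diag_def coord_def)
  next
    case (2 m)
    then show ?thesis
      using sg2[of m] by (auto simp: torus_diag_simps coord_def \<theta>_def)
  next
    case (3 m)
    then show ?thesis
      using sg2[of m] by (auto simp: torus_diag_simps coord_def \<theta>_def cis_conv_exp exp_minus)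
  qed
  have "of_real (\<Prod>t<l. val (sg, \<lambda>_. 1) (lcoord z (\<sigma> t))) = (\<Prod>t<l. torus_val z p \<theta> (\<sigma> t))"
    unfolding of_real_prod
  proof (intro prod.cong refl)
    fix t assume "t \<in> {..<l}"
    then have "\<sigma> t \<in> letters (z + 2 * p) s"
      using word_letter[OF \<sigma>(1)] by simp
    then show "of_real (val (sg, \<lambda>_. 1) (lcoord z (\<sigma> t))) = torus_val z p \<theta> (\<sigma> t)"
      by (auto simp: letters_def diag lcoord_def)
  qed
  also have "\<dots> = torus_diag z p \<theta> (lead z i)"
    by (rule balanced_torus_word[OF \<sigma>(3)])
  also have "\<dots> = of_real (sg i)"
    using \<sigma>(2) by (subst diag) (auto simp: lead_def coord_def)
  finally show ?thesis
    by (simp del: of_real_prod)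
qed

context word_map
begin

lemma radial_proj_monom:
  assumes "\<rho> \<in> real_space (z + p)" "\<mu> \<in> real_space s" "i < z + p"
  shows "radial_proj z p s l (torus_avg z p s l f) (\<rho>, \<mu>) i =
    hom_poly (z + p) s l (\<lambda>e. \<Sum>\<sigma> | \<sigma> \<in> words (z + 2 * p) s l \<and> balanced z p l (lead z i) \<sigma> \<and> proj_exp z l \<sigma> = e.
      Re (\<Psi> (lead z i) * C \<sigma>)) (\<rho>, \<mu>)"
proof -
  define K where "K = (\<lambda>\<sigma>. Re (\<Psi> (lead z i) * C \<sigma>))"
  define S where "S = {\<sigma> \<in> words (z + 2 * p) s l. balanced z p l (lead z i) \<sigma>}"
  have "radial_proj z p s l (torus_avg z p s l f) (\<rho>, \<mu>) i =
      (\<Sum>\<sigma>\<in>S. K \<sigma> * monom_at (z + p) s (proj_exp z l \<sigma>) (\<rho>, \<mu>))"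
    using assms(3) unfolding radial_proj_apply[OF assms(1,2)]
    by (auto intro!: sum.cong simp: prod_val_lcoord S_def K_def)
  also have "\<dots> = (\<Sum>e\<in>hom_exps (z + p) s l. \<Sum>\<sigma> | \<sigma> \<in> S \<and> proj_exp z l \<sigma> = e.
      K \<sigma> * monom_at (z + p) s (proj_exp z l \<sigma>) (\<rho>, \<mu>))"
    by (intro sum.group[symmetric]) (auto simp: S_def proj_exp_in_hom_exps)
  also have "\<dots> = (\<Sum>e\<in>hom_exps (z + p) s l. (\<Sum>\<sigma> | \<sigma> \<in> S \<and> proj_exp z l \<sigma> = e. K \<sigma>) * monom_at (z + p) s e (\<rho>, \<mu>))"
    by (simp add: sum_distrib_right)
  finally show ?thesis
    by (simp add: hom_poly_eq S_def K_def conj_assoc)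
qed

lemma radial_proj_Hsign: "radial_proj z p s l (torus_avg z p s l f) \<in> Hsign z p s l"
proof -
  let ?g = "radial_proj z p s l (torus_avg z p s l f)"
  have "?g (dact sg \<rho>, \<mu>) i = dact sg (?g (\<rho>, \<mu>)) i"
    if sg: "sg \<in> sign_group z p" and \<rho>: "\<rho> \<in> real_space (z + p)" and \<mu>: "\<mu> \<in> real_space s" for sg \<rho> \<mu> i
  proof -
    have "dact sg \<rho> \<in> real_space (z + p)"
      using \<rho> by (simp add: topspace_Euclidean_space dact_def)
    then show ?thesis
      unfolding dact_def[of sg "?g _"] using sg \<rho> \<mu>
      by (auto simp: radial_proj_apply val_dact prod.distrib sign_balanced_word sum_distrib_left mult_ac
          intro!: sum.cong)
  qed
  moreover have "?g \<in> real_space (z + p) \<times> real_space s \<rightarrow> real_space (z + p)"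
    by (auto simp: radial_proj_apply topspace_Euclidean_space[of "z + p"])
  moreover have "\<exists>c. \<forall>\<rho>\<in>real_space (z + p). \<forall>\<mu>\<in>real_space s. \<forall>i<z + p.
      ?g (\<rho>, \<mu>) i = hom_poly (z + p) s l (c i) (\<rho>, \<mu>)"
    by (intro exI[of _ "\<lambda>i e. \<Sum>\<sigma> | \<sigma> \<in> words (z + 2 * p) s l \<and> balanced z p l (lead z i) \<sigma> \<and> proj_exp z l \<sigma> = e.
      Re (\<Psi> (lead z i) * C \<sigma>)"]) (simp add: radial_proj_monom)
  ultimately show ?thesis
    using radial_proj_ext unfolding Hsign_def by (auto simp: fun_eq_iff)
qed

end

text \<open>Induction on the number \<open>q\<close> of coordinates whose reflection has been used.
  Averaging the value with the one transported by the reflection of coordinate \<open>z + q\<close>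
  removes the monomials of wrong parity. The argument compares values, not coefficients.\<close>

lemma Hsign_odd_type:
  assumes "g \<in> Hsign z p s l"
  obtains c where "\<And>\<rho> \<mu> i. \<rho> \<in> real_space (z + p) \<Longrightarrow> \<mu> \<in> real_space s \<Longrightarrow> i < z + p \<Longrightarrow>
    g (\<rho>, \<mu>) i = (\<Sum>e | e \<in> hom_exps (z + p) s l \<and> odd_type z p i e. c i e * monom_at (z + p) s e (\<rho>, \<mu>))"
proof -
  obtain c where c: "\<And>\<rho> \<mu> i. \<rho> \<in> real_space (z + p) \<Longrightarrow> \<mu> \<in> real_space s \<Longrightarrow> i < z + p \<Longrightarrow>
      g (\<rho>, \<mu>) i = hom_poly (z + p) s l (c i) (\<rho>, \<mu>)"
    and eqv: "\<And>sg \<rho> \<mu>. sg \<in> sign_group z p \<Longrightarrow> \<rho> \<in> real_space (z + p) \<Longrightarrow> \<mu> \<in> real_space s \<Longrightarrow>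
      g (dact sg \<rho>, \<mu>) = dact sg (g (\<rho>, \<mu>))"
    using assms unfolding Hsign_def by blast
  have "g (\<rho>, \<mu>) i = (\<Sum>e | e \<in> hom_exps (z + p) s l \<and> odd_type z q i e. c i e * monom_at (z + p) s e (\<rho>, \<mu>))"
    if "q \<le> p" "\<rho> \<in> real_space (z + p)" "\<mu> \<in> real_space s" "i < z + p" for q \<rho> \<mu> i
    using that
  proof (induction q arbitrary: \<rho>)
    case 0
    then show ?case
      by (simp add: c hom_poly_eq odd_type_def)
  next
    case (Suc q)
    let ?S = "{e. e \<in> hom_exps (z + p) s l \<and> odd_type z q i e}"
    define sg :: "nat \<Rightarrow> real" where "sg = (\<lambda>k. if k = z + q then - 1 else 1)"
    have sg: "sg \<in> sign_group z p"
      using Suc.prems by (auto simp: sign_group_def sg_def)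
    have \<rho>': "dact sg \<rho> \<in> real_space (z + p)"
      using Suc.prems by (simp add: topspace_Euclidean_space dact_def)
    have m: "monom_at (z + p) s e (dact sg \<rho>, \<mu>) = (- 1) ^ fst e (z + q) * monom_at (z + p) s e (\<rho>, \<mu>)" for e
    proof -
      have "(\<Prod>k<z + p. sg k ^ fst e k) = (\<Prod>k<z + p. if k = z + q then (- 1) ^ fst e k else 1)"
        by (intro prod.cong) (auto simp: sg_def)
      also have "\<dots> = (- 1) ^ fst e (z + q)"
        using Suc.prems(1) by simp
      finally show ?thesis
        by (simp add: monom_at_def dact_def power_mult_distrib prod.distrib)
    qed
    have A: "g (\<rho>, \<mu>) i = (\<Sum>e\<in>?S. c i e * monom_at (z + p) s e (\<rho>, \<mu>))"
      using Suc by simp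
    have B: "sg i * g (\<rho>, \<mu>) i = (\<Sum>e\<in>?S. (- 1) ^ fst e (z + q) * (c i e * monom_at (z + p) s e (\<rho>, \<mu>)))"
      using Suc.IH[OF _ \<rho>'] Suc.prems eqv[OF sg Suc.prems(2,3)] by (simp add: dact_def[of _ "g _"] m mult_ac)
    \<comment> \<open>Since \<open>sg i\<close> squares to 1, the value is the mean of two terms,
      each of which has an expansion.\<close>
    have "g (\<rho>, \<mu>) i = (g (\<rho>, \<mu>) i + sg i * (sg i * g (\<rho>, \<mu>) i)) / 2"
      by (simp add: sg_def)
    also have "\<dots> = ((\<Sum>e\<in>?S. c i e * monom_at (z + p) s e (\<rho>, \<mu>)) +
        sg i * (\<Sum>e\<in>?S. (- 1) ^ fst e (z + q) * (c i e * monom_at (z + p) s e (\<rho>, \<mu>)))) / 2"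
      by (rule arg_cong2[OF A B, where f = "\<lambda>a b. (a + sg i * b) / 2"])
    also have "\<dots> = (\<Sum>e\<in>?S. (1 + sg i * (- 1) ^ fst e (z + q)) / 2 * (c i e * monom_at (z + p) s e (\<rho>, \<mu>)))"
      by (simp add: sum_distrib_left sum_divide_distrib field_simps flip: sum.distrib)
    \<comment> \<open>The factor is 1 if the parity at \<open>z + q\<close> fits component
      \<open>i\<close>, and 0 otherwise.\<close>
    also have "\<dots> = (\<Sum>e | e \<in> hom_exps (z + p) s l \<and> odd_type z (Suc q) i e. c i e * monom_at (z + p) s e (\<rho>, \<mu>))"
      by (intro sum.mono_neutral_cong_right) (auto simp: odd_type_def sg_def less_Suc_eq minus_one_power_iff split: if_splits)
    finally show ?case .
  qed
  from this[OF order.refl] show ?thesis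
    using that by blast
qed

section \<open>Delays as linear substitutions of letters\<close>

definition ext_mat :: "(nat \<Rightarrow> nat \<Rightarrow> 'a) \<Rightarrow> nat + nat \<Rightarrow> nat + nat \<Rightarrow> 'a::zero_neq_one"
  where "ext_mat M a b = (case a of
           Inl m \<Rightarrow> (case b of Inl k \<Rightarrow> M m k | Inr _ \<Rightarrow> 0)
         | Inr m \<Rightarrow> (case b of Inl _ \<Rightarrow> 0 | Inr k \<Rightarrow> of_bool (m = k)))"

lemma ext_mat_simps [simp]:
  "ext_mat M (Inl m) (Inl k) = M m k" "ext_mat M (Inl m) (Inr b) = 0"
  "ext_mat M (Inr a) (Inl k) = 0" "ext_mat M (Inr a) (Inr b) = of_bool (a = b)"
  by (simp_all add: ext_mat_def)

lemma delay_row_real_space: "delay_row z p \<omega> \<tau> x \<in> real_space (z + p)"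
  by (simp add: topspace_Euclidean_space delay_row_def)

text \<open>Delays leave the parameters unchanged, which is why \<open>ext_mat\<close> continues the
  matrix by an identity block.\<close>

lemma val_delay_row:
  assumes "x \<in> cspace z p" "a \<in> letters (z + p) s"
  shows "of_real (val (delay_row z p \<omega> \<tau> x, \<mu>) a) =
    (\<Sum>b\<in>letters (z + 2 * p) s. ext_mat (delay_matrix z p \<omega> \<tau>) a b * val (x, \<mu>) b)"
  using assms by (cases a) (auto simp: letters_def[of "z + p"] delay_row_real sum_letters mult.commute of_bool_def
      if_distrib[of "\<lambda>u. _ * u"] cong: if_cong)

lemma word_sum_Hreal: "restrict (\<lambda>y. \<Sum>w\<in>words n s l. c w * (\<Prod>t<l. val y (w t))) (real_space n \<times> real_space s) \<in> Hreal n s l"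
  unfolding Hreal_def sum_words_eq_hom_poly by blast

text \<open>Replace every letter of \<open>h\<close> by its linear form and expand with
  \<open>prod_sum_words\<close>; collecting the words in \<open>x\<close> gives the
  coefficients.\<close>

lemma word_map_delay_map:
  assumes "\<Psi> \<in> cspace z p"
  shows "word_map z p s l \<Psi> (\<lambda>\<sigma>. \<Sum>w\<in>words (z + p) s l. of_real (c w) * (\<Prod>t<l. ext_mat (delay_matrix z p \<omega> \<tau>) (w t) (\<sigma> t)))
    (delay_map z p s l \<omega> \<Psi> \<tau> (restrict (\<lambda>y. \<Sum>w\<in>words (z + p) s l. c w * (\<Prod>t<l. val y (w t)))
      (real_space (z + p) \<times> real_space s)))"
    (is "word_map _ _ _ _ _ ?C (delay_map _ _ _ _ _ _ _ ?h)")
proof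
  have f: "delay_map z p s l \<omega> \<Psi> \<tau> ?h =
      restrict (\<lambda>(x, \<mu>). \<lambda>i. \<Psi> i * of_real (?h (delay_row z p \<omega> \<tau> x, \<mu>))) (cspace z p \<times> real_space s)"
    using word_sum_Hreal by (simp add: delay_map_def)
  show "delay_map z p s l \<omega> \<Psi> \<tau> ?h \<in> extensional (cspace z p \<times> real_space s)"
    unfolding f by simp
  show "delay_map z p s l \<omega> \<Psi> \<tau> ?h \<in> cspace z p \<times> real_space s \<rightarrow> cspace z p"
    unfolding f using assms by (auto simp: cspace_def)
  fix x \<mu> i
  assume x: "x \<in> cspace z p" and \<mu>: "\<mu> \<in> real_space s"
  let ?E = "ext_mat (delay_matrix z p \<omega> \<tau>)"
  have "of_real (?h (delay_row z p \<omega> \<tau> x, \<mu>)) =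
      (\<Sum>w\<in>words (z + p) s l. of_real (c w) * (\<Prod>t<l. of_real (val (delay_row z p \<omega> \<tau> x, \<mu>) (w t))) :: complex)"
    using delay_row_real_space \<mu> by simp
  also have "\<dots> = (\<Sum>w\<in>words (z + p) s l. of_real (c w) * (\<Prod>t<l. \<Sum>b\<in>letters (z + 2 * p) s. ?E (w t) b * val (x, \<mu>) b))"
    by (intro sum.cong refl arg_cong2[where f = "(*)"] prod.cong) (auto simp: val_delay_row[OF x word_letter])
  also have "\<dots> = (\<Sum>\<sigma>\<in>words (z + 2 * p) s l. ?C \<sigma> * (\<Prod>t<l. val (x, \<mu>) (\<sigma> t)))"
    unfolding prod_sum_words sum_distrib_left sum_distrib_right by (subst sum.swap) (simp add: mult.assoc)
  finally show "delay_map z p s l \<omega> \<Psi> \<tau> ?h (x, \<mu>) i = \<Psi> i * (\<Sum>\<sigma>\<in>words (z + 2 * p) s l. ?C \<sigma> * (\<Prod>t<l. val (x, \<mu>) (\<sigma> t)))"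
    using x \<mu> by (simp add: f)
qed

subsection \<open>Determinants\<close>

text \<open>The row \<open>y\<close> is \<open>b\<close> times the inverse matrix
  \<open>B\<close>.\<close>

lemma det_solvable:
  fixes N :: "nat \<Rightarrow> nat \<Rightarrow> 'a::field"
  assumes "Determinant.det (Matrix.mat n n (\<lambda>(i, j). N i j)) \<noteq> 0"
  shows "\<exists>y. \<forall>j<n. (\<Sum>i<n. y i * N i j) = b j"
proof -
  let ?A = "Matrix.mat n n (\<lambda>(i, j). N i j)"
  have "?A \<in> Units (ring_mat TYPE('a) n ())"
    by (rule det_non_zero_imp_unit[OF _ assms]) simp
  then obtain B where B: "B \<in> carrier_mat n n" "B * ?A = 1\<^sub>m n"
    unfolding Units_def ring_mat_def by auto
  define y where "y = (\<lambda>i. \<Sum>k<n. b k * B $$ (k, i))"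
  have "(\<Sum>i<n. y i * N i j) = b j" if "j < n" for j
  proof -
    have BA: "(\<Sum>i<n. B $$ (k, i) * N i j) = of_bool (k = j)" if "k < n" for k
    proof -
      have "(B * ?A) $$ (k, j) = (\<Sum>i<n. B $$ (k, i) * N i j)"
        using B(1) \<open>k < n\<close> \<open>j < n\<close> by (simp add: scalar_prod_def atLeast0LessThan)
      moreover have "(B * ?A) $$ (k, j) = of_bool (k = j)"
        unfolding B(2) using \<open>k < n\<close> \<open>j < n\<close> by simp
      ultimately show ?thesis
        by (rule trans[OF sym])
    qed
    have "(\<Sum>i<n. y i * N i j) = (\<Sum>k<n. b k * (\<Sum>i<n. B $$ (k, i) * N i j))"
      unfolding y_def sum_distrib_left sum_distrib_right by (subst sum.swap) (simp add: mult.assoc)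
    also have "\<dots> = (\<Sum>k<n. if k = j then b k else 0)"
      by (intro sum.cong) (auto simp: BA)
    finally show ?thesis
      using that by simp
  qed
  then show ?thesis by blast
qed

text \<open>This form shows the determinant as a polynomial in the entries, so limits and entire
  extensions of the entries carry over to it.\<close>

lemma det_mat_leibniz:
  "Determinant.det (Matrix.mat n n (\<lambda>(i, j). N i j)) =
     (\<Sum>\<pi> | \<pi> permutes {0..<n}. signof \<pi> * (\<Prod>i = 0..<n. N i (\<pi> i)))"
  by (subst det_def'[of _ n]) (auto intro!: sum.cong prod.cong simp: permutes_in_image)

lemma tendsto_det:
  fixes N :: "'b \<Rightarrow> nat \<Rightarrow> nat \<Rightarrow> 'a::real_normed_field"
  assumes "\<And>i j. i < n \<Longrightarrow> j < n \<Longrightarrow> ((\<lambda>x. N x i j) \<longlongrightarrow> N' i j) F"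
  shows "((\<lambda>x. Determinant.det (Matrix.mat n n (\<lambda>(i, j). N x i j))) \<longlongrightarrow>
    Determinant.det (Matrix.mat n n (\<lambda>(i, j). N' i j))) F"
  unfolding det_mat_leibniz
  by (intro tendsto_sum tendsto_mult tendsto_const tendsto_prod assms) (auto simp: permutes_in_image)

lemma det_diagonal_nonzero:
  fixes N :: "nat \<Rightarrow> nat \<Rightarrow> 'a::field"
  assumes "\<And>i. i < n \<Longrightarrow> N i i \<noteq> 0" "\<And>i j. i < n \<Longrightarrow> j < n \<Longrightarrow> i \<noteq> j \<Longrightarrow> N i j = 0"
  shows "Determinant.det (Matrix.mat n n (\<lambda>(i, j). N i j)) \<noteq> 0"
proof -
  have "upper_triangular (Matrix.mat n n (\<lambda>(i, j). N i j))"
    using assms(2) by (auto simp: upper_triangular_def)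
  then have "Determinant.det (Matrix.mat n n (\<lambda>(i, j). N i j)) = prod_list (diag_mat (Matrix.mat n n (\<lambda>(i, j). N i j)))"
    by (rule det_upper_triangular[where n = n]) simp
  then show ?thesis
    using assms(1) by (auto simp: diag_mat_def prod_list_zero_iff)
qed

subsection \<open>Functions that are entire along lines\<close>

text \<open>Holomorphy in one variable suffices, because density is tested on the line through two
  points. Base point and direction stay real; only the line parameter becomes complex.\<close>

definition line_entire :: "((nat \<Rightarrow> real) \<Rightarrow> complex) \<Rightarrow> bool"
  where "line_entire G \<longleftrightarrow>
    (\<forall>a b. \<exists>F. F holomorphic_on UNIV \<and> (\<forall>t. F (of_real t) = G (\<lambda>m. a m + t * b m)))"

lemma line_entire_const: "line_entire (\<lambda>_. c)"
  unfolding line_entire_def by (intro allI exI[of _ "\<lambda>_. c"]) auto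

lemma line_entire_add: "line_entire G \<Longrightarrow> line_entire H \<Longrightarrow> line_entire (\<lambda>\<tau>. G \<tau> + H \<tau>)"
  unfolding line_entire_def by (metis holomorphic_on_add)

lemma line_entire_mult: "line_entire G \<Longrightarrow> line_entire H \<Longrightarrow> line_entire (\<lambda>\<tau>. G \<tau> * H \<tau>)"
  unfolding line_entire_def by (metis holomorphic_on_mult)

lemma line_entire_sum: "(\<And>i. i \<in> A \<Longrightarrow> line_entire (G i)) \<Longrightarrow> line_entire (\<lambda>\<tau>. \<Sum>i\<in>A. G i \<tau>)"
  by (induction A rule: infinite_finite_induct) (auto intro: line_entire_const line_entire_add)

lemma line_entire_prod: "(\<And>i. i \<in> A \<Longrightarrow> line_entire (G i)) \<Longrightarrow> line_entire (\<lambda>\<tau>. \<Prod>i\<in>A. G i \<tau>)"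
  by (induction A rule: infinite_finite_induct) (auto intro: line_entire_const line_entire_mult)

text \<open>The conjugate of \<open>F\<close> is not holomorphic in general, but
  \<open>cnj \<circ> F \<circ> cnj\<close> is, and both agree at real parameters.\<close>

lemma line_entire_cnj:
  assumes "line_entire G"
  shows "line_entire (\<lambda>\<tau>. cnj (G \<tau>))"
  unfolding line_entire_def
proof (intro allI)
  fix a b
  obtain F where F: "F holomorphic_on UNIV" "\<And>t. F (of_real t) = G (\<lambda>m. a m + t * b m)"
    using assms unfolding line_entire_def by blast
  have "(cnj \<circ> F \<circ> cnj) holomorphic_on UNIV"
    using F(1) by (intro holomorphic_on_compose_cnj_cnj) (auto intro: holomorphic_on_subset)
  then show "\<exists>F. F holomorphic_on UNIV \<and> (\<forall>t. F (of_real t) = cnj (G (\<lambda>m. a m + t * b m)))"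
    using F(2) by (intro exI[of _ "cnj \<circ> F \<circ> cnj"]) auto
qed

lemma line_entire_Re:
  assumes "line_entire G"
  shows "line_entire (\<lambda>\<tau>. of_real (Re (G \<tau>)))"
proof -
  have "(\<lambda>\<tau>. of_real (Re (G \<tau>))) = (\<lambda>\<tau>. 1 / 2 * (G \<tau> + cnj (G \<tau>)))"
    by (simp add: complex_add_cnj)
  then show ?thesis
    using assms by (simp only:) (intro line_entire_mult line_entire_add line_entire_const line_entire_cnj)
qed

lemma line_entire_cis: "line_entire (\<lambda>\<tau>. cis (c * \<tau> m))"
  unfolding line_entire_def
proof (intro allI exI conjI)
  fix a b :: "nat \<Rightarrow> real" and t :: real
  show "(\<lambda>w. exp (\<i> * (of_real c * (of_real (a m) + w * of_real (b m))))) holomorphic_on UNIV"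
    by (intro holomorphic_intros)
  show "exp (\<i> * (of_real c * (of_real (a m) + of_real t * of_real (b m)))) = cis (c * (a m + t * b m))"
    by (simp add: cis_conv_exp)
qed

lemma line_entire_delay_matrix: "line_entire (\<lambda>\<tau>. delay_matrix z p \<omega> \<tau> m k)"
proof (cases rule: pair_index_cases[where k = k and z = z and p = p])
  case 1
  then show ?thesis
    by (auto simp: delay_matrix_def torus_diag_def line_entire_const)
next
  case (2 j)
  then show ?thesis
    by (simp add: delay_matrix_def torus_diag_simps line_entire_cis)
next
  case (3 j)
  then show ?thesis
    using line_entire_cis[of "- \<omega> j" m] by (simp add: delay_matrix_def torus_diag_simps)
qed

text \<open>Join the point of \<open>T\<close> (parameter 0) to the point where \<open>G\<close> is
  nonzero (parameter 1). If \<open>G\<close> vanished on the line near 0, the identity theorem would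
  make it vanish at 1.\<close>

lemma line_entire_nonzero_dense:
  assumes G: "line_entire G" and \<tau>1: "G \<tau>\<^sub>1 \<noteq> 0" "\<tau>\<^sub>1 \<in> real_space d"
    and T: "open T" and \<tau>0: "\<tau>\<^sub>0 \<in> T" "\<tau>\<^sub>0 \<in> real_space d"
  shows "\<exists>\<tau>\<in>T \<inter> real_space d. G \<tau> \<noteq> 0"
proof -
  define line where "line = (\<lambda>t::real. \<lambda>m. \<tau>\<^sub>0 m + t * (\<tau>\<^sub>1 m - \<tau>\<^sub>0 m))"
  obtain F where F: "F holomorphic_on UNIV" "\<And>t. F (of_real t) = G (line t)"
    using G unfolding line_entire_def line_def by meson
  have "continuous_on UNIV line"
    unfolding line_def by (intro continuous_on_coordinatewise_then_product continuous_intros)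
  then have "open (line -` T)"
    using T by (simp add: open_vimage)
  moreover have "0 \<in> line -` T"
    using \<tau>0 by (simp add: line_def)
  ultimately obtain \<epsilon> where \<epsilon>: "\<epsilon> > 0" "ball 0 \<epsilon> \<subseteq> line -` T"
    by (meson openE)
  have "\<exists>t\<in>ball 0 \<epsilon>. G (line t) \<noteq> 0"
  proof (rule ccontr)
    assume "\<not> ?thesis"
    then have zero: "F (of_real t) = 0" if "\<bar>t\<bar> < \<epsilon>" for t
      using that by (auto simp: F)
    define U where "U = complex_of_real ` {-\<epsilon><..<\<epsilon>}"
    \<comment> \<open>A real interval accumulates at 0, which is enough for the identity
      theorem.\<close>
    have lim: "0 islimpt U"
      unfolding islimpt_approachable
    proof (intro allI impI)
      fix e :: real assume "e > 0"
      then show "\<exists>x'\<in>U. x' \<noteq> 0 \<and> dist x' 0 < e"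
        unfolding U_def using \<epsilon>(1) by (intro bexI[of _ "of_real (min e \<epsilon> / 2)"] conjI imageI)
          (simp_all add: min_def)
    qed
    have "F 1 = 0"
      by (rule analytic_continuation[of F UNIV U 0, OF F(1) _ _ _ _ lim]) (use zero in \<open>auto simp: U_def\<close>)
    then show False
      using F(2)[of 1] \<tau>1 by (simp add: line_def)
  qed
  then obtain t where "t \<in> ball 0 \<epsilon>" "G (line t) \<noteq> 0"
    by blast
  moreover have "line t \<in> real_space d"
    using \<tau>0 \<tau>1 by (simp add: line_def topspace_Euclidean_space)
  ultimately show ?thesis
    using \<epsilon>(2) by blast
qed

text \<open>Kronecker's theorem on simultaneous approximation, rescaled from period 1 to period
  \<open>2 * pi\<close>.\<close>

lemma kronecker_angles:
  assumes indep: "\<forall>q :: nat \<Rightarrow> rat. (\<Sum>j<p. of_rat (q j) * \<omega> j) = 0 \<longrightarrow> (\<forall>j<p. q j = 0)"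
    and "\<epsilon> > 0"
  shows "\<exists>t h. \<forall>j<p. \<bar>\<omega> j * t - 2 * pi * of_int (h j) - \<phi> j\<bar> < \<epsilon>"
proof -
  interpret M: Modules.module "\<lambda>r x. real_of_int r * x"
    by (simp add: Modules.module.intro distrib_left mult.commute)
  \<comment> \<open>Independence below concerns the set of frequencies, so they must be distinct;
    two equal ones would satisfy a relation with coefficients 1 and -1.\<close>
  have inj: "inj_on \<omega> {..<p}"
  proof (rule inj_onI, rule ccontr)
    fix a b assume ab: "a \<in> {..<p}" "b \<in> {..<p}" "\<omega> a = \<omega> b" "a \<noteq> b"
    define q :: "nat \<Rightarrow> rat" where "q = (\<lambda>j. of_bool (j = a) - of_bool (j = b))"
    have "(\<Sum>j<p. of_rat (q j) * \<omega> j) = (\<Sum>j<p. if j = a then \<omega> j else 0) - (\<Sum>j<p. if j = b then \<omega> j else 0)"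
      unfolding sum_subtractf[symmetric] by (intro sum.cong) (auto simp: q_def)
    also have "\<dots> = 0"
      using ab by simp
    finally have "q a = 0"
      using indep ab by blast
    then show False
      using ab by (simp add: q_def)
  qed
  have "M.independent (\<omega> ` {..<p})"
  proof
    assume "M.dependent (\<omega> ` {..<p})"
    then obtain t u where t: "finite t" "t \<subseteq> \<omega> ` {..<p}" "(\<Sum>v\<in>t. real_of_int (u v) * v) = 0" "\<exists>v\<in>t. u v \<noteq> 0"
      unfolding M.dependent_explicit by blast
    \<comment> \<open>An integer relation between frequencies is pulled back to the indices, with
      coefficient 0 outside \<open>t\<close>.\<close>
    define q :: "nat \<Rightarrow> rat" where "q = (\<lambda>j. if \<omega> j \<in> t then of_int (u (\<omega> j)) else 0)"
    define J where "J = {j. j < p \<and> \<omega> j \<in> t}"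
    have J: "inj_on \<omega> J" "t = \<omega> ` J"
      using inj t(2) by (auto simp: J_def intro: inj_on_subset)
    have "(\<Sum>j<p. of_rat (q j) * \<omega> j) = (\<Sum>j\<in>J. real_of_int (u (\<omega> j)) * \<omega> j)"
      by (intro sum.mono_neutral_cong_right) (auto simp: J_def q_def)
    also have "\<dots> = (\<Sum>v\<in>t. real_of_int (u v) * v)"
      unfolding J(2) sum.reindex[OF J(1)] by simp
    finally have "\<forall>j<p. q j = 0"
      using indep t(3) by simp
    then show False
      using t(4) unfolding J(2) by (auto simp: J_def q_def)
  qed
  \<comment> \<open>Targets and tolerance are divided by \<open>2 * pi\<close>; the time found is
    multiplied by it afterwards.\<close>
  then obtain t h where th: "\<And>i. i < p \<Longrightarrow> \<bar>t * \<omega> i - of_int (h i) - \<phi> i / (2 * pi)\<bar> < \<epsilon> / (2 * pi)"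
    using Kronecker_thm_1[of \<omega> p "\<epsilon> / (2 * pi)" "\<lambda>i. \<phi> i / (2 * pi)"] inj \<open>\<epsilon> > 0\<close> by auto
  have "\<bar>\<omega> j * (2 * pi * t) - 2 * pi * of_int (h j) - \<phi> j\<bar> < \<epsilon>" if "j < p" for j
  proof -
    have "\<omega> j * (2 * pi * t) - 2 * pi * of_int (h j) - \<phi> j = 2 * pi * (t * \<omega> j - of_int (h j) - \<phi> j / (2 * pi))"
      by (simp add: field_simps)
    then have "\<bar>\<omega> j * (2 * pi * t) - 2 * pi * of_int (h j) - \<phi> j\<bar> = 2 * pi * \<bar>t * \<omega> j - of_int (h j) - \<phi> j / (2 * pi)\<bar>"
      by (simp add: abs_mult)
    then show ?thesis
      using th[OF that] by (simp add: field_simps)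
  qed
  then show ?thesis by blast
qed

subsection \<open>The coefficient matrix\<close>

text \<open>
  The coefficient of the monomial \<open>e\<close> in the component \<open>i\<close> of the image of the test polynomial
  \<open>\<Prod>\<^sub>t (L v)\<^bsub>w t\<^esub>\<close>, where \<open>E\<close> replaces \<open>E\<^sub>\<tau>\<close>.
\<close>

definition test_entry :: "nat \<Rightarrow> nat \<Rightarrow> nat \<Rightarrow> nat \<Rightarrow> (nat \<Rightarrow> complex) \<Rightarrow> (nat \<Rightarrow> nat \<Rightarrow> real) \<Rightarrow>
    (nat \<Rightarrow> nat \<Rightarrow> complex) \<Rightarrow> (nat \<Rightarrow> nat + nat) \<Rightarrow> nat \<times> (nat \<Rightarrow> nat) \<times> (nat \<Rightarrow> nat) \<Rightarrow> real"
  where "test_entry z p s l \<Psi> L E w = (\<lambda>(i, e).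
    \<Sum>\<sigma> | \<sigma> \<in> words (z + 2 * p) s l \<and> balanced z p l (lead z i) \<sigma> \<and> proj_exp z l \<sigma> = e.
      Re (\<Psi> (lead z i) * (\<Prod>t<l. \<Sum>a\<in>letters (z + p) s. of_real (ext_mat L (w t) a) * ext_mat E a (\<sigma> t))))"

text \<open>The pairs of a component and a monomial allowed in it index both the equations and the
  test polynomials, so the linear system is square.\<close>

definition target_index :: "nat \<Rightarrow> nat \<Rightarrow> nat \<Rightarrow> nat \<Rightarrow> (nat \<times> (nat \<Rightarrow> nat) \<times> (nat \<Rightarrow> nat)) set"
  where "target_index z p s l = (SIGMA i:{..<z + p}. {e \<in> hom_exps (z + p) s l. odd_type z p i e})"

text \<open>A solution \<open>y\<close> of the system gives a combination of test polynomials whose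
  image has the coefficients of \<open>g\<close>.\<close>

lemma Hsign_subset_image:
  fixes z p :: nat and \<omega> \<tau> :: "nat \<Rightarrow> real"
  defines "E \<equiv> delay_matrix z p \<omega> \<tau>"
  assumes \<Psi>: "\<Psi> \<in> cspace z p"
    and solvable: "\<And>b. \<exists>y. \<forall>c\<in>target_index z p s l.
      (\<Sum>r\<in>target_index z p s l. y r * test_entry z p s l \<Psi> L E (W r) c) = b c"
    and g: "g \<in> Hsign z p s l"
  shows "g \<in> (radial_proj z p s l \<circ> torus_avg z p s l \<circ> delay_map z p s l \<omega> \<Psi> \<tau>) ` Hreal (z + p) s l"
proof -
  let ?I = "target_index z p s l"
  obtain k where k: "\<And>\<rho> \<mu> i. \<rho> \<in> real_space (z + p) \<Longrightarrow> \<mu> \<in> real_space s \<Longrightarrow> i < z + p \<Longrightarrow>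
    g (\<rho>, \<mu>) i = (\<Sum>e | e \<in> hom_exps (z + p) s l \<and> odd_type z p i e. k i e * monom_at (z + p) s e (\<rho>, \<mu>))"
    using Hsign_odd_type[OF g] by blast
  obtain y where y: "\<And>i e. (i, e) \<in> ?I \<Longrightarrow> (\<Sum>r\<in>?I. y r * test_entry z p s l \<Psi> L E (W r) (i, e)) = k i e"
    using solvable[of "\<lambda>(i, e). k i e"] by fastforce
  \<comment> \<open>The word coefficients of this combination after expanding the linear forms given
    by \<open>L\<close>.\<close>
  define c where "c = (\<lambda>w. \<Sum>r\<in>?I. y r * (\<Prod>t<l. ext_mat L (W r t) (w t)))"
  define h where "h = restrict (\<lambda>y. \<Sum>w\<in>words (z + p) s l. c w * (\<Prod>t<l. val y (w t)))
      (real_space (z + p) \<times> real_space s)"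
  define C where "C = (\<lambda>\<sigma>. \<Sum>w\<in>words (z + p) s l. of_real (c w) * (\<Prod>t<l. ext_mat E (w t) (\<sigma> t)))"
  interpret word_map z p s l \<Psi> C "delay_map z p s l \<omega> \<Psi> \<tau> h"
    unfolding C_def h_def E_def by (rule word_map_delay_map[OF \<Psi>])
  define B where "B = (\<lambda>r \<sigma>. \<Prod>t<l. \<Sum>a\<in>letters (z + p) s. of_real (ext_mat L (W r t) a) * ext_mat E a (\<sigma> t))"
  have "C \<sigma> = (\<Sum>w\<in>words (z + p) s l. \<Sum>r\<in>?I. of_real (y r) * (\<Prod>t<l. of_real (ext_mat L (W r t) (w t)) * ext_mat E (w t) (\<sigma> t)))" for \<sigma>
    by (simp add: C_def c_def sum_distrib_right prod.distrib mult.assoc)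
  \<comment> \<open>Summing over the intermediate words composes \<open>L\<close> with
    \<open>E\<close>.\<close>
  then have C: "C \<sigma> = (\<Sum>r\<in>?I. of_real (y r) * B r \<sigma>)" for \<sigma>
    unfolding B_def prod_sum_letters sum_distrib_left by (subst sum.swap) simp
  let ?g = "radial_proj z p s l (torus_avg z p s l (delay_map z p s l \<omega> \<Psi> \<tau> h))"
  have "?g = g"
  proof (rule extensionalityI[OF radial_proj_ext])
    show "g \<in> extensional (real_space (z + p) \<times> real_space s)"
      using g by (simp add: Hsign_def)
    fix x assume "x \<in> real_space (z + p) \<times> real_space s"
    then obtain \<rho> \<mu> where x: "x = (\<rho>, \<mu>)" and m: "\<rho> \<in> real_space (z + p)" "\<mu> \<in> real_space s"
      by blast
    have "?g (\<rho>, \<mu>) i = g (\<rho>, \<mu>) i" for i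
    proof (cases "i < z + p")
      case False
      have "g (\<rho>, \<mu>) \<in> real_space (z + p)"
        using g m unfolding Hsign_def by blast
      then show ?thesis
        using False m by (simp add: radial_proj_apply topspace_Euclidean_space)
    next
      case True
      let ?S = "\<lambda>e. {\<sigma>. \<sigma> \<in> words (z + 2 * p) s l \<and> balanced z p l (lead z i) \<sigma> \<and> proj_exp z l \<sigma> = e}"
      have coeff: "(\<Sum>\<sigma>\<in>?S e. Re (\<Psi> (lead z i) * C \<sigma>)) = (\<Sum>r\<in>?I. y r * test_entry z p s l \<Psi> L E (W r) (i, e))" for e
      proof -
        have "Re (\<Psi> (lead z i) * C \<sigma>) = (\<Sum>r\<in>?I. y r * Re (\<Psi> (lead z i) * B r \<sigma>))" for \<sigma>
        proof -
          have "\<Psi> (lead z i) * C \<sigma> = (\<Sum>r\<in>?I. of_real (y r) * (\<Psi> (lead z i) * B r \<sigma>))"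
            by (simp add: C sum_distrib_left mult_ac)
          then show ?thesis
            by (simp only: Re_sum Re_complex_of_real Im_complex_of_real times_complex.sel) simp
        qed
        then have "(\<Sum>\<sigma>\<in>?S e. Re (\<Psi> (lead z i) * C \<sigma>)) = (\<Sum>\<sigma>\<in>?S e. \<Sum>r\<in>?I. y r * Re (\<Psi> (lead z i) * B r \<sigma>))"
          by (simp only:)
        also have "\<dots> = (\<Sum>r\<in>?I. \<Sum>\<sigma>\<in>?S e. y r * Re (\<Psi> (lead z i) * B r \<sigma>))"
          by (rule sum.swap)
        finally show ?thesis
          by (simp only: test_entry_def prod.case sum_distrib_left B_def)
      qed
      \<comment> \<open>No other monomials occur in the image, so the equations over
        \<open>target_index\<close> determine all its coefficients.\<close>
      have empty: "?S e = {}" if "\<not> odd_type z p i e" for e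
        using balanced_odd_type[OF _ True] that by blast
      have "?g (\<rho>, \<mu>) i = (\<Sum>e\<in>hom_exps (z + p) s l. (\<Sum>\<sigma>\<in>?S e. Re (\<Psi> (lead z i) * C \<sigma>)) * monom_at (z + p) s e (\<rho>, \<mu>))"
        unfolding radial_proj_monom[OF m True] hom_poly_eq ..
      also have "\<dots> = (\<Sum>e | e \<in> hom_exps (z + p) s l \<and> odd_type z p i e.
          (\<Sum>\<sigma>\<in>?S e. Re (\<Psi> (lead z i) * C \<sigma>)) * monom_at (z + p) s e (\<rho>, \<mu>))"
      proof (intro sum.mono_neutral_right ballI)
        fix e assume "e \<in> hom_exps (z + p) s l - {e \<in> hom_exps (z + p) s l. odd_type z p i e}"
        then have "?S e = {}"
          using empty by blast
        then show "(\<Sum>\<sigma>\<in>?S e. Re (\<Psi> (lead z i) * C \<sigma>)) * monom_at (z + p) s e (\<rho>, \<mu>) = 0"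
          by (simp only: sum.empty mult_zero_left)
      qed auto
      also have "\<dots> = g (\<rho>, \<mu>) i"
        unfolding k[OF m True] coeff
        by (intro sum.cong refl arg_cong2[where f = "(*)"] y) (use True in \<open>auto simp: target_index_def\<close>)
      finally show ?thesis .
    qed
    then show "?g x = g x"
      by (auto simp: x)
  qed
  moreover have "h \<in> Hreal (z + p) s l"
    unfolding h_def by (rule word_sum_Hreal)
  ultimately show ?thesis
    by (intro image_eqI[of _ _ h]) auto
qed

lemma image_subset_Hsign:
  assumes "\<Psi> \<in> cspace z p"
  shows "(radial_proj z p s l \<circ> torus_avg z p s l \<circ> delay_map z p s l \<omega> \<Psi> \<tau>) ` Hreal (z + p) s l \<subseteq> Hsign z p s l"
proof (intro image_subsetI)
  fix h assume "h \<in> Hreal (z + p) s l"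
  then obtain c where h: "h = restrict (hom_poly (z + p) s l c) (real_space (z + p) \<times> real_space s)"
    unfolding Hreal_def by blast
  obtain c' where "\<forall>y. hom_poly (z + p) s l c y = (\<Sum>w\<in>words (z + p) s l. c' w * (\<Prod>t<l. val y (w t)))"
    using hom_poly_eq_sum_words by blast
  then have h': "h = restrict (\<lambda>y. \<Sum>w\<in>words (z + p) s l. c' w * (\<Prod>t<l. val y (w t))) (real_space (z + p) \<times> real_space s)"
    unfolding h by (intro restrict_ext) blast
  show "(radial_proj z p s l \<circ> torus_avg z p s l \<circ> delay_map z p s l \<omega> \<Psi> \<tau>) h \<in> Hsign z p s l"
    unfolding h' comp_def by (rule word_map.radial_proj_Hsign[OF word_map_delay_map[OF assms]])
qed

lemma test_entry_tendsto:
  assumes "\<And>m k. m < z + p \<Longrightarrow> k < z + 2 * p \<Longrightarrow> ((\<lambda>x. E x m k) \<longlongrightarrow> E' m k) F"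
  shows "((\<lambda>x. test_entry z p s l \<Psi> L (E x) w c) \<longlongrightarrow> test_entry z p s l \<Psi> L E' w c) F"
proof -
  have "((\<lambda>x. ext_mat (E x) a b) \<longlongrightarrow> ext_mat E' a b) F" if "a \<in> letters (z + p) s" "b \<in> letters (z + 2 * p) s" for a b
    using that assms by (auto simp: letters_def)
  then show ?thesis
    unfolding test_entry_def
    by (cases c) (auto intro!: tendsto_intros simp del: times_complex.sel dest: word_letter)
qed

lemma line_entire_test_entry:
  "line_entire (\<lambda>\<tau>. of_real (test_entry z p s l \<Psi> L (delay_matrix z p \<omega> \<tau>) w c))"
proof -
  have "line_entire (\<lambda>\<tau>. ext_mat (delay_matrix z p \<omega> \<tau>) a b)" for a b
    by (cases a; cases b) (simp_all add: line_entire_delay_matrix line_entire_const)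
  then show ?thesis
    unfolding test_entry_def
    by (cases c) (auto intro!: line_entire_sum line_entire_Re line_entire_mult line_entire_prod line_entire_const
      simp del: times_complex.sel)
qed

section \<open>Balanced words over a monomial and the diagonal model\<close>

lemma odd_type_unique:
  assumes "odd_type z p i e" "odd_type z p i' e" "i < z + p" "i' < z + p" "z \<le> 1"
  shows "i = i'"
proof (cases "i < z \<and> i' < z")
  \<comment> \<open>One index is \<open>z + j\<close> for some \<open>j\<close>; the exponent there
    is odd, which forces the other index to agree. In the remaining case both are below
    \<open>z \<le> 1\<close>, hence 0.\<close>
  case False
  then obtain j where "j < p" "i = z + j \<or> i' = z + j"
    using assms(3,4) by (metis add_diff_inverse_nat nat_add_left_cancel_less)
  then show ?thesis
    using assms(1,2) by (auto simp: odd_type_def)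
qed (use assms(5) in auto)

text \<open>The positions of each letter \<open>z + j\<close> are split into unconjugated and
  conjugated ones, evenly or with one more of the former if \<open>i = z + j\<close>; the parity
  condition permits this. It will make the diagonal entries nonzero.\<close>

lemma ex_balanced_lift:
  assumes w: "w \<in> words (z + p) s l" and i: "i < z + p" and odd: "odd_type z p i (word_exp l w)"
  shows "\<exists>\<sigma>\<in>words (z + 2 * p) s l. balanced z p l (lead z i) \<sigma> \<and> (\<forall>t<l. lcoord z (\<sigma> t) = w t)"
proof -
  define T where "T = (\<lambda>j. {t. t < l \<and> w t = Inl (z + j)})"
  \<comment> \<open>\<open>U\<close> is to receive the unconjugated variable: half of the positions,
    rounded up.\<close>
  have "\<exists>U. U \<subseteq> T j \<and> (j < p \<longrightarrow> 2 * card U = card (T j) + of_bool (i = z + j))" for j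
  proof (cases "j < p")
    case True
    then have par: "odd (card (T j)) \<longleftrightarrow> i = z + j"
      using odd by (simp add: odd_type_def word_exp_def occs_def T_def)
    then have "even (card (T j) + of_bool (i = z + j))"
      by auto
    then obtain n where n: "card (T j) + of_bool (i = z + j) = 2 * n"
      by (elim evenE)
    \<comment> \<open>In the odd case \<open>T j\<close> is nonempty, so rounding up does not exceed
      its size.\<close>
    then have "n \<le> card (T j)"
      using par by (cases "i = z + j") (auto dest: odd_pos)
    then obtain U where "U \<subseteq> T j" "card U = n"
      using obtain_subset_with_card_n by metis
    then show ?thesis
      using n by (intro exI[of _ U]) auto
  qed auto
  then obtain U where U: "\<And>j. U j \<subseteq> T j" "\<And>j. j < p \<Longrightarrow> 2 * card (U j) = card (T j) + of_bool (i = z + j)"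
    by metis
  define \<sigma> where "\<sigma> = restrict (\<lambda>t. case w t of
      Inl k \<Rightarrow> Inl (if k < z then k else if t \<in> U (k - z) then z + 2 * (k - z) else Suc (z + 2 * (k - z)))
    | Inr b \<Rightarrow> Inr b) {..<l}"
  have \<sigma>: "\<sigma> \<in> words (z + 2 * p) s l"
    using word_letter[OF w] by (fastforce simp: words_def \<sigma>_def letters_def split: sum.splits)
  have proj: "lcoord z (\<sigma> t) = w t" if "t < l" for t
    using that by (auto simp: \<sigma>_def lcoord_def coord_def split: sum.splits)
  have "occs l \<sigma> (Inl (z + 2 * j)) = occs l \<sigma> (Inl (Suc (z + 2 * j))) + of_bool (i = z + j)" if "j < p" for j
  proof -
    have letter: "(\<sigma> t = Inl (z + 2 * j) \<longleftrightarrow> t \<in> U j) \<and> (\<sigma> t = Inl (Suc (z + 2 * j)) \<longleftrightarrow> t \<in> T j - U j)"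
      if "t < l" for t
    proof (cases "w t = Inl (z + j)")
      case True
      then show ?thesis
        using that by (auto simp: \<sigma>_def T_def)
    next
      case False
      then have "t \<notin> T j"
        by (simp add: T_def)
      moreover have "\<sigma> t \<noteq> Inl (z + 2 * j)" "\<sigma> t \<noteq> Inl (Suc (z + 2 * j))"
        using proj[OF that] False by (auto simp: lcoord_def coord_def)
      ultimately show ?thesis
        using U(1)[of j] by auto
    qed
    have "{t. t < l \<and> \<sigma> t = Inl (z + 2 * j)} = U j" "{t. t < l \<and> \<sigma> t = Inl (Suc (z + 2 * j))} = T j - U j"
      using letter U(1)[of j] by (auto simp: T_def)
    moreover have "finite (T j)"
      by (simp add: T_def)
    ultimately show ?thesis
      using U(1)[of j] U(2)[OF that] card_mono[of "T j" "U j"] by (simp add: occs_def card_Diff_subset finite_subset)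
  qed
  then show ?thesis
    using \<sigma> proj by (intro bexI[of _ \<sigma>]) (auto simp: balanced_lead_iff[OF \<sigma> i])
qed

text \<open>As \<open>L\<close> inverts \<open>S\<close>, the composed substitution sends each
  variable of the test polynomial to the letters above it, weighted by phases. So only lifts of
  \<open>w\<close> contribute, and by balance they all carry the same phase.\<close>

lemma test_entry_diagonal:
  fixes S :: "nat \<Rightarrow> nat \<Rightarrow> real"
  assumes L: "\<And>i q. i < z + p \<Longrightarrow> q < z + p \<Longrightarrow> (\<Sum>m<z + p. L i m * S m q) = of_bool (i = q)"
    and E: "\<And>m k. m < z + p \<Longrightarrow> k < z + 2 * p \<Longrightarrow> E m k = of_real (S m (coord z k)) * torus_diag z p \<phi> k"
    and w: "w \<in> words (z + p) s l" and i: "i < z + p"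
  shows "test_entry z p s l \<Psi> L E w (i, e) =
    of_nat (card {\<sigma> \<in> words (z + 2 * p) s l. balanced z p l (lead z i) \<sigma> \<and> proj_exp z l \<sigma> = e \<and>
      (\<forall>t<l. w t = lcoord z (\<sigma> t))}) * Re (\<Psi> (lead z i) * torus_diag z p \<phi> (lead z i))"
proof -
  have LE: "(\<Sum>a\<in>letters (z + p) s. of_real (ext_mat L c a) * ext_mat E a b) =
      (if c = lcoord z b then torus_val z p \<phi> b else 0)"
    if c: "c \<in> letters (z + p) s" and b: "b \<in> letters (z + 2 * p) s" for c b
  proof (cases c)
    case (Inl m)
    show ?thesis
    proof (cases b)
      case b': (Inl k)
      then have k: "k < z + 2 * p" "coord z k < z + p"
        using b by (auto simp: letters_def coord_def)
      have "(\<Sum>a\<in>letters (z + p) s. of_real (ext_mat L c a) * ext_mat E a b) =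
          (\<Sum>n<z + p. of_real (L m n * S n (coord z k)) * torus_diag z p \<phi> k)"
        using k by (simp add: sum_letters Inl b' E mult.assoc)
      also have "\<dots> = of_real (\<Sum>n<z + p. L m n * S n (coord z k)) * torus_diag z p \<phi> k"
        by (simp only: of_real_sum sum_distrib_right)
      finally show ?thesis
        using k c by (subst (asm) L) (auto simp: Inl b' lcoord_def letters_def)
    qed (simp add: sum_letters Inl lcoord_def)
  next
    case (Inr m)
    then have "m < s"
      using c by (auto simp: letters_def)
    then show ?thesis
      by (cases b) (auto simp: Inr sum_letters lcoord_def of_bool_def if_distrib[of "\<lambda>u. u * _"]
          if_distrib[of complex_of_real] cong: if_cong)
  qed
  let ?S = "{\<sigma>. \<sigma> \<in> words (z + 2 * p) s l \<and> balanced z p l (lead z i) \<sigma> \<and> proj_exp z l \<sigma> = e}"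
  let ?c = "Re (\<Psi> (lead z i) * torus_diag z p \<phi> (lead z i))"
  have prod: "(\<Prod>t<l. \<Sum>a\<in>letters (z + p) s. of_real (ext_mat L (w t) a) * ext_mat E a (\<sigma> t)) =
      (if \<forall>t<l. w t = lcoord z (\<sigma> t) then torus_diag z p \<phi> (lead z i) else 0)" if "\<sigma> \<in> ?S" for \<sigma>
  proof -
    have "(\<Prod>t<l. \<Sum>a\<in>letters (z + p) s. of_real (ext_mat L (w t) a) * ext_mat E a (\<sigma> t)) =
        (\<Prod>t<l. if w t = lcoord z (\<sigma> t) then torus_val z p \<phi> (\<sigma> t) else 0)"
      using that w by (intro prod.cong refl LE) (auto dest: word_letter)
    also have "\<dots> = (if \<forall>t<l. w t = lcoord z (\<sigma> t) then torus_diag z p \<phi> (lead z i) else 0)"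
      using that by (auto simp: balanced_torus_word prod_zero_iff)
    finally show ?thesis .
  qed
  have "test_entry z p s l \<Psi> L E w (i, e) = (\<Sum>\<sigma>\<in>?S. if \<forall>t<l. w t = lcoord z (\<sigma> t) then ?c else 0)"
    unfolding test_entry_def prod.case by (intro sum.cong refl, subst prod, assumption) auto
  also have "\<dots> = (\<Sum>\<sigma>\<in>{\<sigma> \<in> ?S. \<forall>t<l. w t = lcoord z (\<sigma> t)}. ?c)"
    by (intro sum.inter_filter[symmetric]) simp
  finally show ?thesis
    by (simp add: conj_assoc del: times_complex.sel)
qed

text \<open>Consecutive rows of \<open>S\<close> differ in one sign, so half their difference
  selects one coordinate. The remaining coordinate, the last one if \<open>z = 0\<close> and the
  first one if \<open>z = 1\<close>, is selected by half the sum of the first and last rows, which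
  have opposite signs in all other columns.\<close>

lemma ex_sign_matrix:
  assumes "z \<le> 1" "p \<ge> 1"
  shows "\<exists>(S :: nat \<Rightarrow> nat \<Rightarrow> real) L. (\<forall>m q. S m q \<in> {1, -1}) \<and> (\<forall>m q. q < z \<longrightarrow> S m q = 1) \<and>
    (\<forall>i<z + p. \<forall>q<z + p. (\<Sum>m<z + p. L i m * S m q) = of_bool (i = q))"
proof -
  let ?d = "z + p"
  define S :: "nat \<Rightarrow> nat \<Rightarrow> real" where "S = (\<lambda>m q. if z \<le> q \<and> q < m + z then - 1 else 1)"
  define L :: "nat \<Rightarrow> nat \<Rightarrow> real" where "L = (\<lambda>i m. if z \<le> i \<and> i - z + 1 < ?d
    then (of_bool (m = i - z) - of_bool (m = i - z + 1)) / 2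
    else (of_bool (m = 0) + of_bool (m = ?d - 1)) / 2)"
  have "(\<Sum>m<?d. L i m * S m q) = of_bool (i = q)" if "i < ?d" "q < ?d" for i q
  proof (cases "z \<le> i \<and> i - z + 1 < ?d")
    case True
    have "(\<Sum>m<?d. L i m * S m q) = (\<Sum>m<?d. if m = i - z then S m q / 2 else 0) - (\<Sum>m<?d. if m = i - z + 1 then S m q / 2 else 0)"
      unfolding sum_subtractf[symmetric] using True by (intro sum.cong) (auto simp: L_def)
    also have "\<dots> = S (i - z) q / 2 - S (i - z + 1) q / 2"
      using True by simp
    also have "\<dots> = of_bool (i = q)"
      using True by (auto simp: S_def)
    finally show ?thesis .
  next
    case False
    have "(\<Sum>m<?d. L i m * S m q) = (\<Sum>m<?d. if m = 0 then S m q / 2 else 0) + (\<Sum>m<?d. if m = ?d - 1 then S m q / 2 else 0)"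
      unfolding sum.distrib[symmetric] using False by (intro sum.cong) (auto simp: L_def)
    also have "\<dots> = S 0 q / 2 + S (?d - 1) q / 2"
      using assms by simp
    also have "\<dots> = of_bool (i = q)"
      using False assms that by (auto simp: S_def)
    finally show ?thesis .
  qed
  moreover have "S m q \<in> {1, -1}" "q < z \<Longrightarrow> S m q = 1" for m q
    by (auto simp: S_def)
  ultimately show ?thesis
    by blast
qed

section \<open>Approximation of arbitrary phases by delays\<close>

lemma continuous_delay_matrix: "continuous_on UNIV (\<lambda>\<tau>. delay_matrix z p \<omega> \<tau> m k)"
proof -
  have c: "continuous_on UNIV (\<lambda>\<tau>::nat \<Rightarrow> real. cis (c * \<tau> m))" for c
    by (intro continuous_intros continuous_on_product_coordinates)
  show ?thesis
    using c[of "\<omega> ((k - z) div 2)"] c[of "- \<omega> ((k - z) div 2)"]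
    by (cases "k < z \<or> z + 2 * p \<le> k"; cases "even (k - z)") (simp_all add: delay_matrix_def torus_diag_def)
qed

text \<open>Row \<open>m\<close> involves only the delay \<open>\<tau> m\<close>, so Kronecker's
  theorem applies to each row separately.\<close>

lemma delay_matrix_approximates_torus:
  assumes indep: "\<forall>q :: nat \<Rightarrow> rat. (\<Sum>j<p. of_rat (q j) * \<omega> j) = 0 \<longrightarrow> (\<forall>j<p. q j = 0)"
  shows "\<exists>\<tau>. (\<forall>n. \<tau> n \<in> real_space d) \<and>
    (\<forall>m<d. \<forall>k. (\<lambda>n. delay_matrix z p \<omega> (\<tau> n) m k) \<longlonglongrightarrow> torus_diag z p (\<theta> m) k)"
proof -
  have "\<forall>n m. \<exists>t h. \<forall>j<p. \<bar>\<omega> j * t - 2 * pi * of_int (h j) - \<theta> m j\<bar> < inverse (real (Suc n))"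
    by (intro allI kronecker_angles[OF indep]) simp
  then obtain t h where th: "\<And>n m j. j < p \<Longrightarrow> \<bar>\<omega> j * t n m - 2 * pi * of_int (h n m j) - \<theta> m j\<bar> < inverse (real (Suc n))"
    unfolding choice_iff by blast
  define \<tau> where "\<tau> = (\<lambda>n m. if m < d then t n m else 0)"
  \<comment> \<open>The two signs of \<open>c\<close> cover both members of a conjugate
    pair.\<close>
  have lim: "(\<lambda>n. cis (c * (\<omega> j * t n m))) \<longlonglongrightarrow> cis (c * \<theta> m j)" if "j < p" "c \<in> {1, -1}" for c j m
  proof -
    have "(\<lambda>n. \<omega> j * t n m - 2 * pi * of_int (h n m j) - \<theta> m j) \<longlonglongrightarrow> 0"
      using th[OF that(1)] by (intro Lim_null_comparison[OF _ LIMSEQ_inverse_real_of_nat] always_eventually)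
        (auto intro: less_imp_le)
    then have "(\<lambda>n. \<omega> j * t n m - 2 * pi * of_int (h n m j)) \<longlonglongrightarrow> \<theta> m j"
      by (rule LIM_zero_cancel)
    then have "(\<lambda>n. cis (c * (\<omega> j * t n m - 2 * pi * of_int (h n m j)))) \<longlonglongrightarrow> cis (c * \<theta> m j)"
      by (intro tendsto_intros)
    moreover have "cis (c * (\<omega> j * t n m - 2 * pi * of_int (h n m j))) = cis (c * (\<omega> j * t n m))" for n
    proof -
      have "cis (c * (\<omega> j * t n m)) = cis (c * (\<omega> j * t n m - 2 * pi * of_int (h n m j))) * cis (2 * pi * (c * of_int (h n m j)))"
        by (simp add: cis_mult algebra_simps)
      moreover have "c * of_int (h n m j) \<in> \<int>"
        using that(2) by auto
      ultimately show ?thesis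
        by (simp add: cis_multiple_2pi)
    qed
    ultimately show ?thesis by simp
  qed
  have "(\<lambda>n. delay_matrix z p \<omega> (\<tau> n) m k) \<longlonglongrightarrow> torus_diag z p (\<theta> m) k" if "m < d" for m k
  proof (cases rule: pair_index_cases[where k = k and z = z and p = p])
    case 1
    then show ?thesis
      by (auto simp: delay_matrix_def torus_diag_def)
  next
    case (2 j)
    then show ?thesis
      using lim[of j 1 m] that by (simp add: delay_matrix_def torus_diag_simps \<tau>_def)
  next
    case (3 j)
    then show ?thesis
      using lim[of j "-1" m] that by (simp add: delay_matrix_def torus_diag_simps \<tau>_def)
  qed
  moreover have "\<tau> n \<in> real_space d" for n
    by (simp add: \<tau>_def topspace_Euclidean_space)
  ultimately show ?thesis
    by blast
qed

section \<open>Phases with a nonsingular coefficient matrix\<close>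

lemma Re_mult_cis_minus_Arg: "Re (w * cis (- Arg w)) = cmod w"
proof -
  have "w * cis (- Arg w) = of_real (cmod w) * (cis (Arg w) * cis (- Arg w))"
    using rcis_cmod_Arg[of w] by (simp add: rcis_def flip: mult.assoc)
  then show ?thesis
    by (simp add: cis_mult)
qed

text \<open>The common phases \<open>\<phi>\<close> make the relevant entries of
  \<open>\<Psi>\<close> real and nonzero, and shifts by \<open>pi\<close> depending on the row
  realize an invertible sign matrix. The coefficient matrix is then diagonal, since a monomial
  determines its component.\<close>

lemma ex_nonsingular_angles:
  fixes n :: nat
  assumes z: "z \<le> 1" and p: "p \<ge> 1" and \<Psi>: "\<Psi> \<in> cspace z p" "\<And>i. i < z + 2 * p \<Longrightarrow> \<Psi> i \<noteq> 0"
    and en: "bij_betw en {0..<n} (target_index z p s l)"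
    and W: "\<And>r. r \<in> target_index z p s l \<Longrightarrow> W r \<in> words (z + p) s l \<and> word_exp l (W r) = snd r"
  shows "\<exists>L \<theta>. Determinant.det (Matrix.mat n n (\<lambda>(i, j).
    test_entry z p s l \<Psi> L (\<lambda>m. torus_diag z p (\<theta> m)) (W (en i)) (en j))) \<noteq> 0"
proof -
  obtain S :: "nat \<Rightarrow> nat \<Rightarrow> real" and L where SL: "(\<forall>m q. S m q \<in> {1, -1}) \<and> (\<forall>m q. q < z \<longrightarrow> S m q = 1) \<and>
      (\<forall>i<z + p. \<forall>q<z + p. (\<Sum>m<z + p. L i m * S m q) = of_bool (i = q))"
    using ex_sign_matrix[OF z p] by blast
  then have S: "S m q \<in> {1, -1}" "q < z \<Longrightarrow> S m q = 1" for m q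
    by blast+
  have L: "(\<Sum>m<z + p. L i m * S m q) = of_bool (i = q)" if "i < z + p" "q < z + p" for i q
    using SL that by blast
  define \<phi> where "\<phi> = (\<lambda>j. - Arg (\<Psi> (z + 2 * j)))"
  \<comment> \<open>The shift in row \<open>m\<close> produces the sign \<open>S m (z + j)\<close>;
    columns below \<open>z\<close> have sign 1 and phase 1 anyway.\<close>
  define \<theta> where "\<theta> = (\<lambda>m j. \<phi> j + (if S m (z + j) = 1 then 0 else pi))"
  have E: "torus_diag z p (\<theta> m) k = of_real (S m (coord z k)) * torus_diag z p \<phi> k" if "k < z + 2 * p" for m k
  proof (cases rule: pair_index_cases[where k = k and z = z and p = p])
    case 1
    then show ?thesis
      using that S(2) by (auto simp: torus_diag_simps coord_def)
  next
    case (2 j)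
    then show ?thesis
      using S(1)[of m "z + j"] by (auto simp: torus_diag_simps coord_def \<theta>_def simp flip: cis_mult)
  next
    case (3 j)
    have "cis (- \<phi> j - pi) = - cis (- \<phi> j)"
      by (simp add: complex_eq_iff cos_diff sin_diff)
    then show ?thesis
      using 3 S(1)[of m "z + j"] by (auto simp: torus_diag_simps coord_def \<theta>_def)
  qed
  have nz: "Re (\<Psi> (lead z i) * torus_diag z p \<phi> (lead z i)) \<noteq> 0" if "i < z + p" for i
  proof (cases "i < z")
    case True
    then have "\<Psi> i \<in> \<real>" "\<Psi> i \<noteq> 0"
      using \<Psi> by (auto simp: cspace_def)
    then show ?thesis
      using True by (auto simp: lead_def torus_diag_simps Reals_def)
  next
    case False
    then have "torus_diag z p \<phi> (lead z i) = cis (- Arg (\<Psi> (lead z i)))"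
      using that by (simp add: lead_def torus_diag_simps \<phi>_def)
    moreover have "\<Psi> (lead z i) \<noteq> 0"
      using that False by (intro \<Psi>(2)) (simp add: lead_def)
    ultimately show ?thesis
      by (simp only: Re_mult_cis_minus_Arg norm_eq_zero not_False_eq_True)
  qed
  define T where "T = (\<lambda>w i e. {\<sigma> \<in> words (z + 2 * p) s l. balanced z p l (lead z i) \<sigma> \<and> proj_exp z l \<sigma> = e \<and>
      (\<forall>t<l. w t = lcoord z (\<sigma> t))})"
  have entry: "test_entry z p s l \<Psi> L (\<lambda>m. torus_diag z p (\<theta> m)) (W r) (i, e) = 0 \<longleftrightarrow> T (W r) i e = {}"
    if "r \<in> target_index z p s l" "i < z + p" for r i e
  proof -
    have "finite (T (W r) i e)"
      by (simp add: T_def)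
    moreover have "test_entry z p s l \<Psi> L (\<lambda>m. torus_diag z p (\<theta> m)) (W r) (i, e) =
        of_nat (card (T (W r) i e)) * Re (\<Psi> (lead z i) * torus_diag z p \<phi> (lead z i))"
      unfolding T_def using W[OF that(1)] that(2) by (intro test_entry_diagonal[OF L E]) auto
    ultimately show ?thesis
      using nz[OF that(2)] by (simp only: mult_eq_0_iff of_nat_eq_0_iff card_0_eq simp_thms)
  qed
  define M where "M = (\<lambda>a b. test_entry z p s l \<Psi> L (\<lambda>m. torus_diag z p (\<theta> m)) (W (en a)) (en b))"
  have "M a a \<noteq> 0" if "a < n" for a
  proof -
    from that have r: "en a \<in> target_index z p s l"
      using en by (auto simp: bij_betw_def)
    obtain i e where ie: "en a = (i, e)"
      by (cases "en a")
    have i: "i < z + p" and e: "odd_type z p i e"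
      using r ie by (auto simp: target_index_def)
    obtain \<sigma> where \<sigma>: "\<sigma> \<in> words (z + 2 * p) s l" "balanced z p l (lead z i) \<sigma>" "\<And>t. t < l \<Longrightarrow> lcoord z (\<sigma> t) = W (en a) t"
      using ex_balanced_lift[of "W (en a)" z p s l i] W[OF r] i e ie by auto
    have "proj_exp z l \<sigma> = e"
      using W[OF r] ie \<sigma>(3) by (auto simp: proj_exp_def word_exp_def occs_def cong: conj_cong)
    then have "\<sigma> \<in> T (W (en a)) i e"
      using \<sigma> by (simp add: T_def)
    then have "test_entry z p s l \<Psi> L (\<lambda>m. torus_diag z p (\<theta> m)) (W (en a)) (i, e) \<noteq> 0"
      unfolding entry[OF r i] by blast
    then show ?thesis
      unfolding M_def ie .
  qed
  moreover have "M a b = 0" if ab: "a < n" "b < n" "a \<noteq> b" for a b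
  proof -
    have r: "en a \<in> target_index z p s l" "en b \<in> target_index z p s l"
      using ab by (auto intro!: bij_betw_apply[OF en])
    have ne: "en a \<noteq> en b"
      using ab inj_on_eq_iff[OF bij_betw_imp_inj_on[OF en], of a b] by simp
    obtain i e where ie: "en a = (i, e)"
      by (cases "en a")
    obtain i' e' where ie': "en b = (i', e')"
      by (cases "en b")
    have i: "i < z + p" "odd_type z p i e" "i' < z + p" "odd_type z p i' e'"
      using r ie ie' by (auto simp: target_index_def)
    \<comment> \<open>A word counted here would force equal monomials, hence equal
      components.\<close>
    have "T (W (en a)) i' e' = {}"
    proof (rule ccontr)
      assume "T (W (en a)) i' e' \<noteq> {}"
      then obtain \<sigma> where \<sigma>: "proj_exp z l \<sigma> = e'" "\<And>t. t < l \<Longrightarrow> W (en a) t = lcoord z (\<sigma> t)"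
        by (auto simp: T_def)
      have "word_exp l (W (en a)) = proj_exp z l \<sigma>"
        using \<sigma>(2) by (auto simp: proj_exp_def word_exp_def occs_def cong: conj_cong)
      then have "e = e'"
        using W[OF r(1)] ie \<sigma>(1) by simp
      then show False
        using odd_type_unique[of z p i e i'] i z ne ie ie' by simp
    qed
    then show ?thesis
      unfolding M_def ie' entry[OF r(1) i(3)] .
  qed
  ultimately have "Determinant.det (Matrix.mat n n (\<lambda>(i, j). M i j)) \<noteq> 0"
    by (rule det_diagonal_nonzero)
  then show ?thesis
    unfolding M_def by blast
qed

section \<open>Openness, density and surjectivity for generic delays\<close>

theorem proposition4p3:
  fixes p s l z d \<kappa> :: nat and \<omega> :: "nat \<Rightarrow> real" and \<Psi> :: "nat \<Rightarrow> complex"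
  assumes "p \<ge> 1" and "l \<ge> 2"
    and dims: "(z, d, \<kappa>) = (0, p, 2 * p) \<or> (z, d, \<kappa>) = (1, p + 1, 2 * p + 1)"
    and "\<forall>j<p. \<omega> j > 0"
    and indep: "\<forall>q :: nat \<Rightarrow> rat. (\<Sum>j<p. of_rat (q j) * \<omega> j) = 0 \<longrightarrow> (\<forall>j<p. q j = 0)"
    and "\<Psi> \<in> cspace z p" and "\<forall>i<\<kappa>. \<Psi> i \<noteq> 0"
  shows "\<exists>U. openin (Euclidean_space d) U \<and>
             Euclidean_space d closure_of U = topspace (Euclidean_space d) \<and>
             (\<forall>\<tau>\<in>U. (radial_proj z p s l \<circ> torus_avg z p s l \<circ> delay_map z p s l \<omega> \<Psi> \<tau>)
                        ` Hreal d s l = Hsign z p s l)"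
proof -
  have z: "z \<le> 1" and d: "d = z + p" and \<Psi>: "\<And>i. i < z + 2 * p \<Longrightarrow> \<Psi> i \<noteq> 0"
    using dims assms(7) by auto
  let ?I = "target_index z p s l"
  define n where "n = card ?I"
  have "finite ?I"
    by (simp add: target_index_def)
  then obtain en where en: "bij_betw en {0..<n} ?I"
    unfolding n_def using ex_bij_betw_nat_finite by blast
  have "\<forall>r\<in>?I. \<exists>w. w \<in> words (z + p) s l \<and> word_exp l w = snd r"
    using ex_word by (fastforce simp: target_index_def)
  from bchoice[OF this] obtain W where W: "\<And>r. r \<in> ?I \<Longrightarrow> W r \<in> words (z + p) s l \<and> word_exp l (W r) = snd r"
    by blast
  obtain L \<theta> where nonsing: "Determinant.det (Matrix.mat n n (\<lambda>(i, j).
      test_entry z p s l \<Psi> L (\<lambda>m. torus_diag z p (\<theta> m)) (W (en i)) (en j))) \<noteq> 0"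
    using ex_nonsingular_angles[OF z assms(1,6) \<Psi> en W] by blast
  define N where "N = (\<lambda>\<tau> i j. test_entry z p s l \<Psi> L (delay_matrix z p \<omega> \<tau>) (W (en i)) (en j))"
  define D where "D = (\<lambda>\<tau>. Determinant.det (Matrix.mat n n (\<lambda>(i, j). N \<tau> i j)))"
  \<comment> \<open>The good delays are those for which the square system of coefficients is
    nonsingular.\<close>
  define U where "U = {\<tau> \<in> real_space d. D \<tau> \<noteq> 0}"
  have "continuous_on UNIV D"
    unfolding continuous_on_def D_def N_def
    by (intro ballI tendsto_det test_entry_tendsto)
      (use continuous_delay_matrix in \<open>auto simp: continuous_on_def\<close>)
  then have "open {\<tau>. D \<tau> \<noteq> 0}"
    by (intro open_Collect_neq continuous_on_const)
  then have "openin (Euclidean_space d) U"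
    unfolding Euclidean_space_def openin_subtopology euclidean_product_topology
    by (intro exI[of _ "{\<tau>. D \<tau> \<noteq> 0}"]) (auto simp: U_def topspace_Euclidean_space)
  moreover have "Euclidean_space d closure_of U = topspace (Euclidean_space d)"
  proof -
    obtain \<tau> where \<tau>: "\<And>n. \<tau> n \<in> real_space d"
      "\<And>m k. m < d \<Longrightarrow> (\<lambda>n. delay_matrix z p \<omega> (\<tau> n) m k) \<longlonglongrightarrow> torus_diag z p (\<theta> m) k"
      using delay_matrix_approximates_torus[OF indep, of d z \<theta>] by blast
    \<comment> \<open>Along delays that approximate the ideal phases \<open>\<theta>\<close> the
      determinant tends to a nonzero value, so it is nonzero at some
      \<open>\<tau> k\<close>.\<close>
    have "(\<lambda>n. D (\<tau> n)) \<longlonglongrightarrow> Determinant.det (Matrix.mat n n (\<lambda>(i, j).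
        test_entry z p s l \<Psi> L (\<lambda>m. torus_diag z p (\<theta> m)) (W (en i)) (en j)))"
      unfolding D_def N_def by (intro tendsto_det test_entry_tendsto) (use \<tau>(2) d in auto)
    then have "\<forall>\<^sub>F k in sequentially. D (\<tau> k) \<noteq> 0"
      using nonsing by (rule tendsto_imp_eventually_ne)
    then obtain k where k: "D (\<tau> k) \<noteq> 0"
      by (auto simp: eventually_sequentially)
    have G: "line_entire (\<lambda>\<tau>. of_real (D \<tau>))"
    proof -
      have "(\<lambda>\<tau>. complex_of_real (D \<tau>)) = (\<lambda>\<tau>. \<Sum>\<pi> | \<pi> permutes {0..<n}.
          of_real (signof \<pi>) * (\<Prod>i = 0..<n. of_real (N \<tau> i (\<pi> i))))"
        by (simp add: D_def det_mat_leibniz)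
      then show ?thesis
        unfolding N_def
        by (simp only:) (intro line_entire_sum line_entire_mult line_entire_prod line_entire_const line_entire_test_entry)
    qed
    \<comment> \<open>Every relatively open set is searched along a line towards
      \<open>\<tau> k\<close>.\<close>
    have "\<exists>y. y \<in> U \<and> y \<in> T" if x: "x \<in> real_space d" "x \<in> T" "openin (Euclidean_space d) T" for x T
    proof -
      obtain T' where T': "open T'" "T = T' \<inter> real_space d"
        using x(3) unfolding Euclidean_space_def openin_subtopology euclidean_product_topology
        by (auto simp: topspace_Euclidean_space)
      then show ?thesis
        using line_entire_nonzero_dense[OF G, of "\<tau> k" d T' x] k \<tau>(1) x by (auto simp: U_def)
    qed
    then show ?thesis
      by (auto simp: in_closure_of)
  qed
  moreover have "(radial_proj z p s l \<circ> torus_avg z p s l \<circ> delay_map z p s l \<omega> \<Psi> \<tau>) ` Hreal d s l = Hsign z p s l"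
    if "\<tau> \<in> U" for \<tau>
  proof -
    have det: "Determinant.det (Matrix.mat n n (\<lambda>(i, j). N \<tau> i j)) \<noteq> 0"
      using that by (simp add: U_def D_def)
    have "\<exists>y. \<forall>c\<in>?I. (\<Sum>r\<in>?I. y r * test_entry z p s l \<Psi> L (delay_matrix z p \<omega> \<tau>) (W r) c) = b c" for b
    proof -
      obtain y where y: "\<And>j. j < n \<Longrightarrow> (\<Sum>i<n. y i * N \<tau> i j) = b (en j)"
        using det_solvable[OF det, of "\<lambda>j. b (en j)"] by blast
      \<comment> \<open>The solution is indexed by numbers; the inverse of \<open>en\<close> carries
        it to the index set.\<close>
      define y' where "y' = (\<lambda>r. y (the_inv_into {0..<n} en r))"
      have "(\<Sum>r\<in>?I. y' r * test_entry z p s l \<Psi> L (delay_matrix z p \<omega> \<tau>) (W r) c) = b c" if "c \<in> ?I" for c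
      proof -
        have "c \<in> en ` {0..<n}"
          using en that by (simp add: bij_betw_def)
        then obtain j where j: "j < n" "c = en j"
          by auto
        have "(\<Sum>r\<in>?I. y' r * test_entry z p s l \<Psi> L (delay_matrix z p \<omega> \<tau>) (W r) c) =
            (\<Sum>i\<in>{0..<n}. y' (en i) * test_entry z p s l \<Psi> L (delay_matrix z p \<omega> \<tau>) (W (en i)) c)"
          by (rule sum.reindex_bij_betw[OF en, symmetric])
        also have "\<dots> = (\<Sum>i<n. y i * N \<tau> i j)"
          using en by (intro sum.cong) (auto simp: y'_def N_def j the_inv_into_f_f bij_betw_def)
        finally show ?thesis
          using y j by simp
      qed
      then show ?thesis by blast
    qed
    then have "Hsign z p s l \<subseteq> (radial_proj z p s l \<circ> torus_avg z p s l \<circ> delay_map z p s l \<omega> \<Psi> \<tau>) ` Hreal d s l"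
      unfolding d using Hsign_subset_image[OF assms(6)] by blast
    then show ?thesis
      using image_subset_Hsign[OF assms(6)] unfolding d by blast
  qed
  ultimately show ?thesis
    by blast
qed

end
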